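(* For each $\lambda>0$ and $\beta>0$ there exists $K^*\in\mathbb{Z}_+$ such that for any odd $K\ge K^*$ the process $\mathcal{M}$ on the cyclic graph $C_K$ (with total exogenous arrival rate $\lambda$ per node, service rate $1$ and swap rate $\beta$) is transient.
   Context: Let $K\ge 3$ be odd and let $C_K=\mathbb{Z}/K\mathbb{Z}$ be the cyclic graph with vertex set $V_K=\{1,\dots,K\}$ and edges $(1,2),\dots,(K-1,K),(K,1)$; $\mathrm{dist}$ is graph distance on $C_K$. Let $V_K^*$ be the set of finite words (including the empty word $\varnothing$) in the alphabet $V_K$, and let $Q=(V_K^* )^{V_K}$. The queue $q^v=(q^v_1,\dots,q^v_{h_v})\in V_K^*$ of the server currently located at node $v$ lists, in order of arrival (FIFO), the destinations (elements of $V_K$) of the customers present, $h_v$ being the queue length. $\mathcal{M}=\mathcal{M}(t)$ is the continuous-time Markov process on the countable state space $Q$ with the following transitions. (Arrivals) For $v,w\in V_K$, with rate $\lambda_{v,w}\ge 0$, an exogenous customer with destination $w$ arrives at node $v$, and $q^v$ is replaced by $q^v$ with $w$ appended at the end. The rates $\lambda_{v,w}$ depend only on $w-v$ mod $K$, and $\lambda=\sum_w\lambda_{v,w}$ is the total exogenous arrival rate at each node. (Services) Each node $v$ has an independent Poisson clock of rate $1$. When it rings and $h_v>0$, the first customer $q_1^v$ is removed from $q^v$. If $\mathrm{dist}(v,q_1^v)\le 1$ the customer leaves the network; otherwise it is appended at the end of the queue at the unique neighbor $w$ of $v$ with $\mathrm{dist}(w,q_1^v)=\mathrm{dist}(v,q_1^v)-1$.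 If $h_v=0$ nothing happens. (Swaps) Each edge $uv$ has an independent Poisson clock of rate $\beta>0$. When it rings, the whole queues $q^u$ and $q^v$ exchange positions. Transience is in the usual sense for continuous-time Markov chains on a countable state space. *)

theory Defs
  imports "HOL-Probability.Probability"
begin

section \<open>Continuous-time Markov chains on a countable state space\<close>

text \<open>
  A chain is given by its jump rates \<open>q x y\<close> for \<open>x \<noteq> y\<close>; the diagonal values of \<open>q\<close> are
  never used. The chain is built from its jump chain and holding times.
\<close>

definition exit_rate :: "('s \<Rightarrow> 's \<Rightarrow> real) \<Rightarrow> 's \<Rightarrow> real" where
  "exit_rate q x = (\<Sum>\<^sub>\<infinity>y\<in>-{x}. q x y)"

definition jump_pmf :: "('s \<Rightarrow> 's \<Rightarrow> real) \<Rightarrow> 's \<Rightarrow> 's pmf" where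
  "jump_pmf q x =
     (if exit_rate q x > 0 then embed_pmf (\<lambda>y. if y = x then 0 else q x y / exit_rate q x)
      else return_pmf x)"

text \<open>
  In an absorbing state the chain makes fictitious jumps to the same state at rate 1, so that the
  path is constant from then on.
\<close>

definition holding_law :: "('s \<Rightarrow> 's \<Rightarrow> real) \<Rightarrow> 's \<Rightarrow> real measure" where
  "holding_law q x =
     density lborel (exponential_density (if exit_rate q x > 0 then exit_rate q x else 1))"

text \<open>
  Sample points are sequences \<open>\<omega>\<close> with \<open>\<omega> n = (Y n, S n)\<close>: \<open>Y\<close> is the jump chain and \<open>S (Suc n)\<close>
  is the time spent in \<open>Y n\<close> before the jump to \<open>Y (Suc n)\<close> (while \<open>S 0 = 0\<close>). Given the first
  \<open>n + 1\<close> coordinates, \<open>Y (Suc n)\<close> and \<open>S (Suc n)\<close> are independent with laws determined by \<open>Y n\<close>.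
\<close>

abbreviation step_space :: "('s \<times> real) measure" where
  "step_space \<equiv> count_space UNIV \<Otimes>\<^sub>M borel"

primrec step_kernel ::
  "('s \<Rightarrow> 's \<Rightarrow> real) \<Rightarrow> 's \<Rightarrow> nat \<Rightarrow> (nat \<Rightarrow> 's \<times> real) \<Rightarrow> ('s \<times> real) measure" where
  "step_kernel q x 0 \<omega> = return step_space (x, 0)"
| "step_kernel q x (Suc n) \<omega> =
     measure_pmf (jump_pmf q (fst (\<omega> n))) \<Otimes>\<^sub>M holding_law q (fst (\<omega> n))"

text \<open>
  The law of the chain started at \<open>x\<close>: the Ionescu-Tulcea measure of the kernels above (the
  library provides its defining properties inside the locale instantiated below).
\<close>

definition path_measure ::
  "('s::countable \<Rightarrow> 's \<Rightarrow> real) \<Rightarrow> 's \<Rightarrow> (nat \<Rightarrow> 's \<times> real) measure" where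
  "path_measure q x =
     projective_family.lim UNIV (Ionescu_Tulcea.CI (step_kernel q x) (\<lambda>_. step_space))
       (\<lambda>_. step_space)"

definition jump_time :: "(nat \<Rightarrow> 's \<times> real) \<Rightarrow> nat \<Rightarrow> real" where
  "jump_time \<omega> n = (\<Sum>i\<le>n. snd (\<omega> i))"

text \<open>The minimal process; \<open>None\<close> is the cemetery state entered at an explosion.\<close>

definition ctmc_at :: "(nat \<Rightarrow> 's \<times> real) \<Rightarrow> real \<Rightarrow> 's option" where
  "ctmc_at \<omega> t =
     (if \<exists>n. t < jump_time \<omega> (Suc n)
      then Some (fst (\<omega> (LEAST n. t < jump_time \<omega> (Suc n)))) else None)"

definition transient_state :: "('s::countable \<Rightarrow> 's \<Rightarrow> real) \<Rightarrow> 's \<Rightarrow> bool" where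
  "transient_state q x \<longleftrightarrow>
     (AE \<omega> in path_measure q x. bdd_above {t. 0 \<le> t \<and> ctmc_at \<omega> t = Some x})"

definition transient_ctmc :: "('s::countable \<Rightarrow> 's \<Rightarrow> real) \<Rightarrow> 's set \<Rightarrow> bool" where
  "transient_ctmc q S \<longleftrightarrow> (\<forall>x\<in>S. transient_state q x)"

lemma prob_space_holding_law: "prob_space (holding_law q x)"
  unfolding holding_law_def by (rule prob_space_exponential_density) auto

lemma sets_holding_law [simp, measurable_cong]: "sets (holding_law q x) = sets borel"
  by (simp add: holding_law_def)

lemma Ionescu_Tulcea_step_kernel:
  fixes q :: "'s::countable \<Rightarrow> 's \<Rightarrow> real"
  shows "Ionescu_Tulcea (step_kernel q x) (\<lambda>_. step_space)"
proof (rule Ionescu_Tulcea.intro)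
  define k where "k y = measure_pmf (jump_pmf q y) \<Otimes>\<^sub>M holding_law q y" for y
  have prob_k: "prob_space (k y)" for y
  proof -
    interpret A: prob_space "holding_law q y" by (rule prob_space_holding_law)
    interpret pair_prob_space "measure_pmf (jump_pmf q y)" "holding_law q y" ..
    show ?thesis unfolding k_def by unfold_locales
  qed
  have sets_k: "sets (k y) = sets step_space" for y
    unfolding k_def by (intro sets_pair_measure_cong) auto
  have k: "k \<in> measurable (count_space UNIV) (subprob_algebra step_space)"
    using prob_k sets_k
    by (auto simp: space_subprob_algebra intro: prob_space_imp_subprob_space)
  show "step_kernel q x i \<in> measurable (PiM {0..<i} (\<lambda>_. step_space)) (subprob_algebra step_space)"
    for i
  proof (cases i)
    case 0
    have "return step_space (x, 0) \<in> space (subprob_algebra step_space)"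
      by (auto simp: space_subprob_algebra space_pair_measure
          intro!: prob_space_imp_subprob_space prob_space_return)
    moreover have "step_kernel q x i = (\<lambda>_. return step_space (x, 0))"
      by (simp add: 0 fun_eq_iff)
    ultimately show ?thesis
      by (simp only: measurable_const)
  next
    case (Suc n)
    have "(\<lambda>\<omega>. k (fst (\<omega> n))) \<in> measurable (PiM {0..<i} (\<lambda>_. step_space)) (subprob_algebra step_space)"
      by (rule measurable_compose[OF _ k], rule measurable_compose[OF _ measurable_fst],
          rule measurable_component_singleton) (simp add: Suc)
    moreover have "step_kernel q x i = (\<lambda>\<omega>. k (fst (\<omega> n)))"
      by (simp add: Suc k_def fun_eq_iff)
    ultimately show ?thesis by simp
  qed
  show "prob_space (step_kernel q x i \<omega>)" for i \<omega>
  proof (cases i)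
    case 0
    then show ?thesis by (simp add: prob_space_return space_pair_measure)
  next
    case (Suc n)
    then show ?thesis using prob_k by (simp add: k_def)
  qed
qed

lemma pmf_jump_pmf:
  assumes nonneg: "\<And>y. y \<noteq> x \<Longrightarrow> 0 \<le> q x y"
    and pos: "exit_rate q x > 0"
    and fin: "finite {y. y \<noteq> x \<and> q x y \<noteq> 0}"
  shows "pmf (jump_pmf q x) y = (if y = x then 0 else q x y / exit_rate q x)"
proof -
  let ?A = "{y. y \<noteq> x \<and> q x y \<noteq> 0}"
  let ?f = "\<lambda>y. if y = x then 0 else q x y / exit_rate q x"
  have ex: "exit_rate q x = (\<Sum>y\<in>?A. q x y)"
  proof -
    have "exit_rate q x = infsum (q x) ?A"
      unfolding exit_rate_def by (rule infsum_cong_neutral) auto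
    then show ?thesis using fin by simp
  qed
  have nn: "0 \<le> ?f y" for y using nonneg pos by auto
  have "(\<integral>\<^sup>+y. ennreal (?f y) \<partial>count_space UNIV) = (\<Sum>y\<in>?A. ennreal (?f y))"
    by (rule nn_integral_count_space'[OF fin]) auto
  also have "\<dots> = ennreal (\<Sum>y\<in>?A. ?f y)"
    by (rule sum_ennreal) (rule nn)
  also have "(\<Sum>y\<in>?A. ?f y) = (\<Sum>y\<in>?A. q x y) / exit_rate q x"
    by (simp add: sum_divide_distrib)
  also have "\<dots> = 1" using pos ex by simp
  finally have "(\<integral>\<^sup>+y. ennreal (?f y) \<partial>count_space UNIV) = 1" by simp
  then show ?thesis
    using pos nn by (simp add: jump_pmf_def pmf_embed_pmf)
qed

section \<open>Mobile queues on the cyclic graph\<close>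

text \<open>
  The nodes of \<open>C_K\<close> are the residues \<open>0, \<dots>, K - 1\<close>, i.e. node \<open>K\<close> is written \<open>0\<close>. A state is the
  list of the \<open>K\<close> queues.
\<close>

type_synonym queues = "nat list list"

definition network_states :: "nat \<Rightarrow> queues set" where
  "network_states K = {s. length s = K \<and> (\<forall>q\<in>set s. set q \<subseteq> {..<K})}"

definition cycle_adj :: "nat \<Rightarrow> nat \<Rightarrow> nat \<Rightarrow> bool" where
  "cycle_adj K u v \<longleftrightarrow> u < K \<and> v < K \<and> (v = (u + 1) mod K \<or> u = (v + 1) mod K)"

definition cycle_dist :: "nat \<Rightarrow> nat \<Rightarrow> nat \<Rightarrow> nat" where
  "cycle_dist K u v = (LEAST n. (cycle_adj K ^^ n) u v)"

definition next_hop :: "nat \<Rightarrow> nat \<Rightarrow> nat \<Rightarrow> nat" where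
  "next_hop K v d = (THE w. cycle_adj K v w \<and> cycle_dist K w d + 1 = cycle_dist K v d)"

definition enqueue :: "nat \<Rightarrow> nat \<Rightarrow> queues \<Rightarrow> queues" where
  "enqueue v w s = s[v := s ! v @ [w]]"

definition serve :: "nat \<Rightarrow> nat \<Rightarrow> queues \<Rightarrow> queues" where
  "serve K v s =
     (case s ! v of
        [] \<Rightarrow> s
      | d # ds \<Rightarrow>
          if cycle_dist K v d \<le> 1 then s[v := ds]
          else enqueue (next_hop K v d) d (s[v := ds]))"

definition swap_queues :: "nat \<Rightarrow> nat \<Rightarrow> queues \<Rightarrow> queues" where
  "swap_queues u v s = s[u := s ! v, v := s ! u]"

text \<open>
  Several clocks may induce the same transition, in which case their rates add up. The edges are
  enumerated as \<open>{u, (u + 1) mod K}\<close> with \<open>u < K\<close>, without repetition for \<open>K \<ge> 3\<close>.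
\<close>

definition network_rate ::
  "nat \<Rightarrow> (nat \<Rightarrow> nat \<Rightarrow> real) \<Rightarrow> real \<Rightarrow> queues \<Rightarrow> queues \<Rightarrow> real" where
  "network_rate K arr \<beta> s t =
     (\<Sum>v<K. \<Sum>w<K. arr v w * of_bool (enqueue v w s = t))
   + (\<Sum>v<K. of_bool (serve K v s = t))
   + (\<Sum>u<K. \<beta> * of_bool (swap_queues u ((u + 1) mod K) s = t))"

definition arrival_rates :: "nat \<Rightarrow> real \<Rightarrow> (nat \<Rightarrow> nat \<Rightarrow> real) \<Rightarrow> bool" where
  "arrival_rates K lam arr \<longleftrightarrow>
     (\<forall>v<K. \<forall>w<K. 0 \<le> arr v w)
   \<and> (\<forall>v<K. \<forall>w<K. \<forall>v'<K. \<forall>w'<K.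
        (int w - int v) mod int K = (int w' - int v') mod int K \<longrightarrow> arr v w = arr v' w')
   \<and> (\<forall>v<K. (\<Sum>w<K. arr v w) = lam)"

lemma finite_network_rate_support: "finite {t. network_rate K arr \<beta> s t \<noteq> 0}"
proof (rule finite_subset)
  show "{t. network_rate K arr \<beta> s t \<noteq> 0} \<subseteq>
      (\<lambda>(v, w). enqueue v w s) ` ({..<K} \<times> {..<K}) \<union> (\<lambda>v. serve K v s) ` {..<K}
      \<union> (\<lambda>u. swap_queues u ((u + 1) mod K) s) ` {..<K}" (is "_ \<subseteq> ?B")
  proof (rule subsetI, rule ccontr)
    fix t assume t: "t \<in> {t. network_rate K arr \<beta> s t \<noteq> 0}" and "t \<notin> ?B"
    then have "\<And>v w. v < K \<Longrightarrow> w < K \<Longrightarrow> enqueue v w s \<noteq> t"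
      "\<And>v. v < K \<Longrightarrow> serve K v s \<noteq> t" "\<And>u. u < K \<Longrightarrow> swap_queues u ((u + 1) mod K) s \<noteq> t"
      by auto
    then have "network_rate K arr \<beta> s t = 0"
      by (simp add: network_rate_def)
    with t show False by simp
  qed
qed auto

lemma network_rate_nonneg:
  assumes "arrival_rates K lam arr" "0 \<le> \<beta>"
  shows "0 \<le> network_rate K arr \<beta> s t"
proof -
  have "0 \<le> arr v w" if "v < K" "w < K" for v w
    using assms(1) that unfolding arrival_rates_def by blast
  then show ?thesis
    using assms(2) unfolding network_rate_def
    by (intro add_nonneg_nonneg sum_nonneg mult_nonneg_nonneg) simp_all
qed

end

(*
  Follow one server and let l be the length of its queue. The total arrival rate to the network is
  K lam, but as long as no queue is empty, served customers are only lost at a total rate of at most 3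
  on average: the destination of a first customer is fixed while the swaps mix the locations of the
  servers, so it is within distance 1 with probability about 3/K. Moreover the mixing makes the
  remaining flow equidistribute over all ordered pairs of servers, so after averaging over a long time
  window l has drift about lam - 3/K, which is positive for K large; this needs only that all queues
  are longer than the window. A sum over the servers of exponentials of the time-averaged l, truncated
  at a small level, is then a superharmonic function which is not constant.
*)
theory Submission
  imports Defs "HOL-Combinatorics.Transposition"
begin

section \<open>A transience criterion\<close>

text \<open>The one-step drift of a queue length has no definite sign, since it depends on the first
  customers and on where the servers stand. It can be controlled only \<open>k\<close> steps ahead,
  and there FIFO decouples the expectation: while all queues are longer than \<open>k\<close>, the
  customer found at the head of a queue \<open>k\<close> steps later was in that queue from the
  start. Each contribution to the expected inflow thus depends on one initial queue and on the
  motion of two locations. Swaps preserve sums over pairs of locations, and a Doeblin-type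
  minorization turns the bound on the sum into a bound for every pair. Short queues are handled by
  the truncation: a single short queue already lifts the sum of exponentials to the truncation
  level, where the truncated function is maximal and superharmonicity is automatic. As this function
  is constant on a large set, the transience criterion asks for a strict drop only after some number
  of jumps. The swap rate influences the mixing time and hence the window, but not the threshold
  \<open>3 < K * lam\<close>.\<close>

definition jump_mean ::
  "('s \<Rightarrow> 's \<Rightarrow> real) \<Rightarrow> ('s \<Rightarrow> ennreal) \<Rightarrow> 's \<Rightarrow> ennreal" where
  "jump_mean q f x = (\<integral>\<^sup>+y. f y \<partial>measure_pmf (jump_pmf q x))"

lemma jump_mean_mono: "(\<And>y. f y \<le> g y) \<Longrightarrow> jump_mean q f x \<le> jump_mean q g x"
  unfolding jump_mean_def by (rule nn_integral_mono) auto

lemma jump_mean_pow_mono: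
  "(\<And>y. f y \<le> g y) \<Longrightarrow> (jump_mean q ^^ n) f x \<le> (jump_mean q ^^ n) g x"
  by (induction n arbitrary: x) (auto intro: jump_mean_mono)

lemma jump_mean_pow_add:
  "(jump_mean q ^^ n) (\<lambda>y. f y + g y) x = (jump_mean q ^^ n) f x + (jump_mean q ^^ n) g x"
  by (induction n arbitrary: x) (auto simp: jump_mean_def nn_integral_add)

lemma jump_mean_pow_cmult:
  "(jump_mean q ^^ n) (\<lambda>y. c * f y) x = c * (jump_mean q ^^ n) f x"
  by (induction n arbitrary: x) (auto simp: jump_mean_def nn_integral_cmult)

lemma jump_mean_pow_superharmonic:
  assumes "\<And>y. jump_mean q f y \<le> f y"
  shows "(jump_mean q ^^ n) f x \<le> f x"
proof (induction n arbitrary: x)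
  case (Suc n)
  have "(jump_mean q ^^ Suc n) f x \<le> jump_mean q f x"
    using Suc by (auto intro: jump_mean_mono)
  then show ?case using assms[of x] by (rule order_trans)
qed simp

text \<open>Each kernel is a product whose factors depend only on the current state of the jump
  chain, so the holding times integrate out. The identity is computed for finite compositions of
  kernels and carried to the limit measure through the projection onto the first
  \<open>Suc n\<close> coordinates.\<close>

lemma nn_integral_path_marginal:
  fixes q :: "'s::countable \<Rightarrow> 's \<Rightarrow> real" and f :: "'s \<Rightarrow> ennreal"
  shows "(\<integral>\<^sup>+\<omega>. f (fst (\<omega> n)) \<partial>path_measure q x) = (jump_mean q ^^ n) f x"
proof -
  interpret Ionescu_Tulcea "step_kernel q x" "\<lambda>_. step_space :: ('s \<times> real) measure"
    by (rule Ionescu_Tulcea_step_kernel)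
  let ?M = "\<lambda>_::nat. step_space :: ('s \<times> real) measure"
  let ?u = "\<lambda>_::nat. undefined :: 's \<times> real"
  have f [measurable]: "(\<lambda>\<omega>. f (fst (\<omega> n))) \<in> borel_measurable (PiM {0..<Suc n} ?M)" for f :: "'s \<Rightarrow> ennreal" and n
    by (rule measurable_compose[OF measurable_component_singleton[of n]], simp)
       (rule measurable_compose[OF measurable_fst], simp)
  have u: "?u \<in> space (PiM {0..<0} ?M)"
    by (simp add: space_PiM)
  have C: "(\<integral>\<^sup>+\<omega>. f (fst (\<omega> n)) \<partial>C 0 (Suc n) ?u) = (jump_mean q ^^ n) f x" for f n
  \<comment> \<open>The last kernel is integrated out first, which replaces \<open>f\<close> by
    \<open>jump_mean q f\<close> on a shorter path; hence the generalization over
    \<open>f\<close>.\<close>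
  proof (induction n arbitrary: f)
    case 0
    have "(\<integral>\<^sup>+\<omega>. f (fst (\<omega> 0)) \<partial>C 0 (Suc 0) ?u) = (\<integral>\<^sup>+\<omega>. f (fst (\<omega> 0)) \<partial>eP 0 ?u)"
      unfolding C.simps using bind_return[OF measurable_eP u] by simp
    also have "\<dots> = (\<integral>\<^sup>+y. f (fst y) \<partial>return step_space (x, 0))"
      by (subst nn_integral_eP[OF u]) (use f[of f 0] in auto)
    also have "\<dots> = f x"
      by (subst nn_integral_return) (auto simp: space_pair_measure intro: measurable_compose[OF measurable_fst])
    finally show ?case by simp
  next
    case (Suc n)
    have step: "(\<integral>\<^sup>+y. f (fst y) \<partial>(measure_pmf (jump_pmf q z) \<Otimes>\<^sub>M holding_law q z)) = jump_mean q f z"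
      for f :: "'s \<Rightarrow> ennreal" and z
    proof -
      interpret H: prob_space "holding_law q z" by (rule prob_space_holding_law)
      have [measurable_cong]: "sets (measure_pmf (jump_pmf q z)) = sets (count_space UNIV)" by simp
      have "(\<lambda>y. f (fst y)) \<in> borel_measurable (measure_pmf (jump_pmf q z) \<Otimes>\<^sub>M holding_law q z)"
        by (rule measurable_compose[OF measurable_fst]) simp
      then have "(\<integral>\<^sup>+y. f (fst y) \<partial>(measure_pmf (jump_pmf q z) \<Otimes>\<^sub>M holding_law q z))
        = (\<integral>\<^sup>+y. (\<integral>\<^sup>+t. f y \<partial>holding_law q z) \<partial>measure_pmf (jump_pmf q z))"
        by (subst H.nn_integral_fst[symmetric]) auto
      then show ?thesis
        by (simp add: jump_mean_def H.emeasure_space_1)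
    qed
    have "(\<integral>\<^sup>+\<omega>. f (fst (\<omega> (Suc n))) \<partial>C 0 (Suc (Suc n)) ?u)
      = (\<integral>\<^sup>+\<omega>. f (fst (\<omega> (Suc n))) \<partial>(C 0 (Suc n) ?u \<bind> eP (Suc n)))"
      by simp
    also have "\<dots> = (\<integral>\<^sup>+\<omega>. (\<integral>\<^sup>+\<omega>'. f (fst (\<omega>' (Suc n))) \<partial>eP (Suc n) \<omega>) \<partial>C 0 (Suc n) ?u)"
    proof (rule nn_integral_bind[where B="PiM {0..<Suc (Suc n)} ?M"])
      show "eP (Suc n) \<in> measurable (C 0 (Suc n) ?u) (subprob_algebra (PiM {0..<Suc (Suc n)} ?M))"
        unfolding measurable_cong_sets[OF sets_C[OF u] refl] add_0 by (rule measurable_eP)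
    qed (rule f)
    also have "\<dots> = (\<integral>\<^sup>+\<omega>. jump_mean q f (fst (\<omega> n)) \<partial>C 0 (Suc n) ?u)"
    proof (rule nn_integral_cong)
      fix \<omega> assume "\<omega> \<in> space (C 0 (Suc n) ?u)"
      then have "\<omega> \<in> space (PiM {0..<Suc n} ?M)"
        using space_C[OF u, of "Suc n"] by simp
      then show "(\<integral>\<^sup>+\<omega>'. f (fst (\<omega>' (Suc n))) \<partial>eP (Suc n) \<omega>) = jump_mean q f (fst (\<omega> n))"
        by (subst nn_integral_eP) (use f[of f "Suc n"] step in auto)
    qed
    also have "\<dots> = (jump_mean q ^^ n) (jump_mean q f) x"
      by (rule Suc)
    finally show ?case
      by (simp add: funpow_swap1)
  qed
  define J where "J = {0..<Suc n}"
  have J: "finite J" "n \<in> J" "up_to J \<le> Suc n" "Suc n \<le> up_to J"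
    unfolding J_def using up_to_less[of "{0..<Suc n}" n] by (auto simp: up_to_iff_Ico Suc_le_eq)
  then have upJ: "up_to J = Suc n" by simp
  have fJ: "(\<lambda>\<omega>. f (fst (\<omega> n))) \<in> borel_measurable (PiM J ?M)"
    unfolding J_def by (rule f)
  have "(\<integral>\<^sup>+\<omega>. f (fst (\<omega> n)) \<partial>path_measure q x)
    = (\<integral>\<^sup>+\<omega>. f (fst (restrict \<omega> J n)) \<partial>PF.lim)"
    using J by (simp add: path_measure_def)
  also have "\<dots> = (\<integral>\<^sup>+\<omega>. f (fst (\<omega> n)) \<partial>distr PF.lim (PiM J ?M) (\<lambda>\<omega>. restrict \<omega> J))"
    by (rule nn_integral_distr[symmetric])
       (use fJ measurable_restrict_subset[OF subset_UNIV, of J ?M] in \<open>simp_all only: measurable_cong_sets[OF PF.sets_lim refl] measurable_cong_sets[OF sets_distr refl]\<close>)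
  also have "\<dots> = (\<integral>\<^sup>+\<omega>. f (fst (\<omega> n)) \<partial>CI J)"
    by (simp add: distr_lim J)
  also have "\<dots> = (\<integral>\<^sup>+\<omega>. f (fst (restrict \<omega> J n)) \<partial>C 0 (Suc n) ?u)"
    unfolding CI_def upJ
    by (rule nn_integral_distr)
       (use fJ measurable_restrict_subset[of J "{0..<Suc n}" ?M] in \<open>simp_all only: measurable_cong_sets[OF sets_C[OF u] refl] measurable_cong_sets[OF sets_distr refl] J_def add_0 subset_refl\<close>)
  also have "\<dots> = (jump_mean q ^^ n) f x"
    using C[where f=f and n=n] J by simp
  finally show ?thesis .
qed

text \<open>
  If \<open>f\<close> is superharmonic and drops strictly at \<open>x\<close> after \<open>n\<close> jumps, the potential of the
  function \<open>f - (jump_mean q ^^ n) f\<close>, which is positive at \<open>x\<close>, telescopes and is finite; hence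
  the expected number of visits to \<open>x\<close> is finite.
\<close>

lemma transient_stateI:
  fixes q :: "'s::countable \<Rightarrow> 's \<Rightarrow> real" and f :: "'s \<Rightarrow> ennreal"
  assumes super: "\<And>y. jump_mean q f y \<le> f y"
    and drop: "(jump_mean q ^^ n) f x < f x" and fin: "f x < top"
  shows "transient_state q x"
proof -
  let ?P = "jump_mean q"
  define p where "p j = (?P ^^ j) (indicator {x}) x" for j
  obtain e where e: "0 < e" "e < top" "(?P ^^ n) f x + e \<le> f x"
  proof
    show "0 < f x - (?P ^^ n) f x" using drop by (simp add: diff_gr0_ennreal)
    show "f x - (?P ^^ n) f x < top" using fin by (meson diff_le_self_ennreal le_less_trans)
    show "(?P ^^ n) f x + (f x - (?P ^^ n) f x) \<le> f x"
      using drop by (simp add: add_diff_inverse_ennreal)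
  qed
  have pt: "(?P ^^ n) f y + e * indicator {x} y \<le> f y" for y
    using e jump_mean_pow_superharmonic[OF super, of n y] by (auto split: split_indicator)
  have step: "(?P ^^ (j + n)) f x + e * p j \<le> (?P ^^ j) f x" for j
    using jump_mean_pow_mono[OF pt, where n=j and q=q and x=x]
    by (simp add: jump_mean_pow_add jump_mean_pow_cmult p_def funpow_add)
  have mono: "(?P ^^ j) f x \<le> f x" for j
    by (rule jump_mean_pow_superharmonic[OF super])
  \<comment> \<open>The window sums stay on both sides as additions, because subtraction in
    \<open>ennreal\<close> does not cancel. In the induction step the common term is removed only
    after \<open>mono\<close> shows it finite.\<close>
  have tele: "(\<Sum>j<N. e * p j) + (\<Sum>j<n. (?P ^^ (N + j)) f x) \<le> (\<Sum>j<n. (?P ^^ j) f x)" for N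
  proof (induction N)
    case (Suc N)
    have "(\<Sum>j<n. (?P ^^ (Suc N + j)) f x) + (?P ^^ N) f x
      = (\<Sum>j<Suc n. (?P ^^ (N + j)) f x)"
      by (subst sum.lessThan_Suc_shift) (simp add: add.commute)
    also have "\<dots> = (\<Sum>j<n. (?P ^^ (N + j)) f x) + (?P ^^ (N + n)) f x" by simp
    finally have shift: "(\<Sum>j<n. (?P ^^ (Suc N + j)) f x) + (?P ^^ N) f x
      = (\<Sum>j<n. (?P ^^ (N + j)) f x) + (?P ^^ (N + n)) f x" .
    have "(\<Sum>j<Suc N. e * p j) + (\<Sum>j<n. (?P ^^ (Suc N + j)) f x) + (?P ^^ N) f x
      = (\<Sum>j<N. e * p j) + (\<Sum>j<n. (?P ^^ (N + j)) f x) + ((?P ^^ (N + n)) f x + e * p N)"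
      using shift by (simp add: ac_simps)
    also have "\<dots> \<le> (\<Sum>j<n. (?P ^^ j) f x) + (?P ^^ N) f x"
      by (intro add_mono Suc step)
    finally show ?case
      using mono[of N] fin by (auto simp: ennreal_add_left_cancel_le add.commute[of _ "(?P ^^ N) f x"] top_unique)
  qed simp
  have bound: "(\<Sum>j<N. e * p j) \<le> of_nat n * f x" for N
  proof -
    have "(\<Sum>j<N. e * p j) \<le> (\<Sum>j<n. (?P ^^ j) f x)"
      using tele[of N] by (rule order_trans[rotated]) simp
    also have "\<dots> \<le> (\<Sum>j<n. f x)" by (intro sum_mono mono)
    finally show ?thesis by simp
  qed
  have "(\<Sum>j. e * p j) \<le> of_nat n * f x"
    unfolding suminf_eq_SUP by (rule SUP_least) (rule bound)
  moreover have "of_nat n * f x < top"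
    using fin by (simp add: ennreal_mult_less_top of_nat_less_top)
  ultimately have "e * (\<Sum>j. p j) < top"
    by (simp only: ennreal_suminf_cmult)
  then have sum_fin: "(\<Sum>j. p j) \<noteq> top"
    using e by (auto simp: ennreal_mult_less_top)
  let ?M = "path_measure q x"
  define A where "A j = {\<omega> \<in> space ?M. fst (\<omega> j) = x}" for j
  interpret Ionescu_Tulcea "step_kernel q x" "\<lambda>_. step_space :: ('s \<times> real) measure"
    by (rule Ionescu_Tulcea_step_kernel)
  have sets_M: "sets ?M = sets (PiM UNIV (\<lambda>_::nat. step_space :: ('s \<times> real) measure))"
    by (simp add: path_measure_def)
  have meas: "(\<lambda>\<omega>. fst (\<omega> j)) \<in> measurable ?M (count_space UNIV)" for j
    unfolding measurable_cong_sets[OF sets_M refl]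
    by (rule measurable_compose[OF measurable_component_singleton[of j]], simp) (rule measurable_fst)
  have A: "A j \<in> sets ?M" for j
    using measurable_sets[OF meas[of j], of "{x}"] by (simp add: A_def vimage_def Int_def conj_commute)
  have emA: "emeasure ?M (A j) = p j" for j
  proof -
    have "emeasure ?M (A j) = (\<integral>\<^sup>+\<omega>. indicator (A j) \<omega> \<partial>?M)"
      using A[of j] by simp
    also have "\<dots> = (\<integral>\<^sup>+\<omega>. indicator {x} (fst (\<omega> j)) \<partial>?M)"
      by (rule nn_integral_cong) (auto simp: A_def split: split_indicator)
    finally show ?thesis by (simp add: nn_integral_path_marginal p_def)
  qed
  have p_fin: "p j < top" for j
    using ennreal_suminf_lessD[of p top j] sum_fin by (simp add: less_top)
  then have "p j = ennreal (measure ?M (A j))" for j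
    using emA[of j] emeasure_eq_ennreal_measure[of ?M "A j"] p_fin[of j] by (simp add: less_top)
  then have "summable (\<lambda>j. measure ?M (A j))"
    using sum_fin by (intro summable_suminf_not_top) auto
  \<comment> \<open>Borel-Cantelli: almost surely the jump chain visits \<open>x\<close> finitely
    often.\<close>
  then have "AE \<omega> in ?M. eventually (\<lambda>j. \<omega> \<in> space ?M - A j) sequentially"
    by (intro borel_cantelli_AE1) (use A emA p_fin in auto)
  then have "AE \<omega> in ?M. bdd_above {t. 0 \<le> t \<and> ctmc_at \<omega> t = Some x}"
  proof (rule AE_mp, intro AE_I2 impI)
    fix \<omega> assume \<omega>: "\<omega> \<in> space ?M" "eventually (\<lambda>j. \<omega> \<in> space ?M - A j) sequentially"
    then obtain N where N: "\<And>j. N \<le> j \<Longrightarrow> fst (\<omega> j) \<noteq> x"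
      by (auto simp: eventually_sequentially A_def)
    show "bdd_above {t. 0 \<le> t \<and> ctmc_at \<omega> t = Some x}"
    proof (rule bdd_aboveI)
      fix t assume "t \<in> {t. 0 \<le> t \<and> ctmc_at \<omega> t = Some x}"
      then have ex: "\<exists>j. t < jump_time \<omega> (Suc j)" and
        at: "fst (\<omega> (LEAST j. t < jump_time \<omega> (Suc j))) = x"
        by (auto simp: ctmc_at_def split: if_splits)
      define k where "k = (LEAST j. t < jump_time \<omega> (Suc j))"
      have "t < jump_time \<omega> (Suc k)" unfolding k_def using ex by (rule LeastI_ex)
      moreover have "k < N" using N[of k] at by (auto simp: k_def not_le[symmetric])
      \<comment> \<open>No estimate of holding times is involved: once the jump chain has left
        \<open>x\<close> for good, every time spent in \<open>x\<close> precedes one of finitely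
        many jump times. After an explosion the process is in \<open>None\<close>, so it is not in
        \<open>x\<close> either.\<close>
      ultimately show "t \<le> Max ((\<lambda>j. jump_time \<omega> (Suc j)) ` {..N})"
        by (intro order_trans[OF less_imp_le Max_ge]) auto
    qed
  qed
  then show ?thesis unfolding transient_state_def .
qed

text \<open>With positive probability the next state is \<open>z\<close>, where
  \<open>c - g z\<close> is lost against the upper bound \<open>c\<close>.\<close>

lemma jump_mean_drop:
  assumes le: "\<And>y. g y \<le> c" and c: "c < top"
    and z: "z \<in> set_pmf (jump_pmf q x)" "g z < c"
  shows "jump_mean q g x < c"
proof -
  let ?M = "measure_pmf (jump_pmf q x)" and ?p = "ennreal (pmf (jump_pmf q x) z)"
  have pos: "0 < (c - g z) * ?p"
    using z by (simp add: ennreal_zero_less_mult_iff diff_gr0_ennreal pmf_positive)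
  have "jump_mean q g x + (c - g z) * ?p = (\<integral>\<^sup>+y. g y + (c - g z) * indicator {z} y \<partial>?M)"
    by (simp add: nn_integral_add nn_integral_cmult jump_mean_def emeasure_pmf_single)
  also have "\<dots> \<le> (\<integral>\<^sup>+y. c \<partial>?M)"
    using le z(2) by (intro nn_integral_mono) (auto split: split_indicator simp: add_diff_inverse_ennreal less_imp_le)
  also have "\<dots> = c" by (simp add: measure_pmf.emeasure_space_1)
  finally have *: "jump_mean q g x + (c - g z) * ?p \<le> c" .
  then have "jump_mean q g x \<noteq> c"
    using pos c by (auto simp: ennreal_add_left_cancel_le dest: order_trans)
  moreover have "jump_mean q g x \<le> c"
    using * by (rule order_trans[rotated]) simp
  ultimately show ?thesis by simp
qed

text \<open>A strict inequality at a reachable state propagates backwards along the path;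
  superharmonicity keeps all iterates below \<open>c\<close>, so \<open>jump_mean_drop\<close>
  applies at each step.\<close>

lemma jump_mean_pow_drop:
  assumes "\<And>y. jump_mean q f y \<le> f y" "\<And>y. f y \<le> c" "c < top"
    and "(x, y) \<in> {(x, y). y \<in> set_pmf (jump_pmf q x)} ^^ n" "f y < c"
  shows "(jump_mean q ^^ n) f x < c"
  using assms(4)
proof (induction n arbitrary: x)
  case 0
  then show ?case using assms(5) by simp
next
  case (Suc n)
  then obtain z where z: "z \<in> set_pmf (jump_pmf q x)" "(jump_mean q ^^ n) f z < c"
    by (metis (mono_tags, lifting) case_prodD mem_Collect_eq relpow_Suc_E2)
  have "(jump_mean q ^^ n) f y \<le> c" for y
    using jump_mean_pow_superharmonic[OF assms(1)] assms(2) order_trans by blast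
  then show ?case
    using jump_mean_drop[where g="(jump_mean q ^^ n) f" and q=q and x=x, OF _ assms(3) z] by simp
qed

section \<open>Chains driven by finitely many independent clocks\<close>

context
  fixes q :: "'s \<Rightarrow> 's \<Rightarrow> real" and x :: 's and E :: "'e set" and r :: "'e \<Rightarrow> real" and act :: "'e \<Rightarrow> 's"
  assumes E: "finite E" "\<And>e. e \<in> E \<Longrightarrow> 0 \<le> r e"
    and q: "\<And>y. q x y = (\<Sum>e\<in>E. r e * of_bool (act e = y))"
begin

lemma clocks_rate_nonneg: "0 \<le> q x y"
  unfolding q using E by (intro sum_nonneg) auto

lemma clocks_rate_support: "y \<notin> act ` E \<Longrightarrow> q x y = 0"
  unfolding q by (intro sum.neutral) auto

lemma clocks_exit_rate: "exit_rate q x = (\<Sum>y\<in>act ` E - {x}. q x y)"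
proof -
  have "exit_rate q x = infsum (q x) (act ` E - {x})"
    unfolding exit_rate_def by (rule infsum_cong_neutral) (auto intro: clocks_rate_support)
  then show ?thesis using E by simp
qed

lemma clocks_pmf_jump_pmf:
  assumes "0 < exit_rate q x"
  shows "pmf (jump_pmf q x) y = (if y = x then 0 else q x y / exit_rate q x)"
proof (rule pmf_jump_pmf)
  show "finite {y. y \<noteq> x \<and> q x y \<noteq> 0}"
    by (rule finite_subset[of _ "act ` E"]) (use E(1) clocks_rate_support in blast)+
qed (use clocks_rate_nonneg assms in auto)

lemma clocks_set_jump_pmf:
  assumes "0 < q x y" "y \<noteq> x"
  shows "y \<in> set_pmf (jump_pmf q x)"
proof -
  have "y \<in> act ` E" using clocks_rate_support[of y] assms by auto
  then have "q x y \<le> exit_rate q x"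
    unfolding clocks_exit_rate using assms E by (intro member_le_sum clocks_rate_nonneg) auto
  then show ?thesis
    using assms clocks_pmf_jump_pmf[of y] by (simp add: set_pmf_iff)
qed

text \<open>Clocks that leave \<open>x\<close> fixed add the same amount to both sides of the
  hypothesis, so it is equivalent to a condition on the genuine jumps. In an absorbing state the
  jump law is a point mass.\<close>

lemma clocks_superharmonic:
  fixes U :: "'s \<Rightarrow> real"
  assumes U: "\<And>y. 0 \<le> U y" "(\<Sum>e\<in>E. r e * U (act e)) \<le> (\<Sum>e\<in>E. r e) * U x"
  shows "jump_mean q (\<lambda>y. ennreal (U y)) x \<le> ennreal (U x)"
proof (cases "0 < exit_rate q x")
  case True
  let ?T = "act ` E - {x}"
  have one: "(\<Sum>y\<in>?T. of_bool (act e = y) * (U y - U x)) = U (act e) - U x" if "e \<in> E" for e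
  proof -
    have "(\<Sum>y\<in>?T. of_bool (act e = y) * (U y - U x)) = (\<Sum>y\<in>?T. if y = act e then U y - U x else 0)"
      by (rule sum.cong) auto
    also have "\<dots> = (if act e \<in> ?T then U (act e) - U x else 0)"
      using E by (intro sum.delta) simp
    finally show ?thesis using that by auto
  qed
  have "(\<Sum>y\<in>?T. q x y * (U y - U x)) = (\<Sum>y\<in>?T. \<Sum>e\<in>E. r e * (of_bool (act e = y) * (U y - U x)))"
    unfolding q sum_distrib_right mult.assoc ..
  also have "\<dots> = (\<Sum>e\<in>E. r e * (\<Sum>y\<in>?T. of_bool (act e = y) * (U y - U x)))"
    unfolding sum_distrib_left by (rule sum.swap)
  also have "\<dots> = (\<Sum>e\<in>E. r e * (U (act e) - U x))"
    by (rule sum.cong[OF refl]) (simp only: one)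
  also have "\<dots> \<le> 0"
    using U(2) unfolding right_diff_distrib sum_subtractf sum_distrib_right by simp
  finally have le: "(\<Sum>y\<in>?T. q x y * U y) \<le> exit_rate q x * U x"
    unfolding right_diff_distrib sum_subtractf clocks_exit_rate sum_distrib_right by simp
  have "jump_mean q (\<lambda>y. ennreal (U y)) x
    = (\<integral>\<^sup>+y. ennreal (pmf (jump_pmf q x) y) * ennreal (U y) \<partial>count_space UNIV)"
    unfolding jump_mean_def by (rule nn_integral_measure_pmf)
  also have "\<dots> = (\<Sum>y\<in>?T. ennreal (pmf (jump_pmf q x) y) * ennreal (U y))"
  proof (rule nn_integral_count_space')
    show "ennreal (pmf (jump_pmf q x) y) * ennreal (U y) = 0" if "y \<notin> ?T" for y
      using clocks_pmf_jump_pmf[OF True, of y] clocks_rate_support[of y] that by (cases "y = x") simp_all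
  qed (simp_all add: E(1))
  also have "\<dots> = (\<Sum>y\<in>?T. ennreal (q x y * U y / exit_rate q x))"
  proof (rule sum.cong[OF refl])
    fix y assume "y \<in> ?T"
    then have "pmf (jump_pmf q x) y = q x y / exit_rate q x"
      using clocks_pmf_jump_pmf[OF True, of y] by simp
    then show "ennreal (pmf (jump_pmf q x) y) * ennreal (U y) = ennreal (q x y * U y / exit_rate q x)"
      using U(1)[of y] by (simp add: ennreal_mult''[symmetric])
  qed
  also have "\<dots> = ennreal ((\<Sum>y\<in>?T. q x y * U y) / exit_rate q x)"
    unfolding sum_divide_distrib
    by (rule sum_ennreal) (intro divide_nonneg_pos mult_nonneg_nonneg True U(1) clocks_rate_nonneg)
  also have "\<dots> \<le> ennreal (U x)"
    by (rule ennreal_leI) (use le True in \<open>simp add: pos_divide_le_eq mult.commute\<close>)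
  finally show ?thesis .
qed (simp add: jump_mean_def jump_pmf_def nn_integral_return)

end

section \<open>Distances on the cycle\<close>

lemma cycle_adj_less: "cycle_adj K u v \<Longrightarrow> u < K \<and> v < K"
  by (simp add: cycle_adj_def)

text \<open>For nodes below \<open>K\<close> this is \<open>(v - u) mod K\<close>, the number of
  increasing steps from \<open>u\<close> to \<open>v\<close>. Written by cases on naturals, it suits
  case splits and linear arithmetic.\<close>

definition cyc_arc :: "nat \<Rightarrow> nat \<Rightarrow> nat \<Rightarrow> nat" where
  "cyc_arc K u v = (if u \<le> v then v - u else K + v - u)"

definition arc_dist :: "nat \<Rightarrow> nat \<Rightarrow> nat \<Rightarrow> nat" where
  "arc_dist K u v = min (cyc_arc K u v) (K - cyc_arc K u v)"

lemma arc_less: "u < K \<Longrightarrow> v < K \<Longrightarrow> cyc_arc K u v < K"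
  unfolding cyc_arc_def by auto

lemma arc_inj: "u < K \<Longrightarrow> w < K \<Longrightarrow> v < K \<Longrightarrow> cyc_arc K u v = cyc_arc K w v \<Longrightarrow> u = w"
  unfolding cyc_arc_def by (auto split: if_splits)

lemma Suc_mod_cycle: "(u::nat) < K \<Longrightarrow> (u + 1) mod K = (if u = K - 1 then 0 else u + 1)"
  by (cases K) (auto simp: mod_Suc)

lemma arc_succ:
  assumes "u < K" "v < K"
  shows "cyc_arc K u v = (if cyc_arc K ((u + 1) mod K) v = K - 1 then 0 else cyc_arc K ((u + 1) mod K) v + 1)"
  unfolding Suc_mod_cycle[OF assms(1)] using assms unfolding cyc_arc_def by auto

lemma arc_adj:
  assumes "cycle_adj K u w" "v < K"
  shows "cyc_arc K u v = (if cyc_arc K w v = K - 1 then 0 else cyc_arc K w v + 1) \<or>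
    cyc_arc K w v = (if cyc_arc K u v = K - 1 then 0 else cyc_arc K u v + 1)"
  using assms arc_succ[of u K v] arc_succ[of w K v] unfolding cycle_adj_def by metis

text \<open>An edge changes the arc by one modulo \<open>K\<close>. This Lipschitz property bounds
  the length of any path from below.\<close>

lemma arc_dist_adj:
  assumes "cycle_adj K u w" "v < K"
  shows "arc_dist K u v \<le> Suc (arc_dist K w v)"
proof -
  have "cyc_arc K u v < K" "cyc_arc K w v < K"
    using cycle_adj_less[OF assms(1)] assms(2) by (auto intro: arc_less)
  moreover have "min a (K - a) \<le> Suc (min b (K - b))"
    if "a < K" "b < K" "a = (if b = K - 1 then 0 else b + 1) \<or> b = (if a = K - 1 then 0 else a + 1)"
    for a b
    using that by (auto simp: min_def split: if_splits)
  ultimately show ?thesis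
    using arc_adj[OF assms] unfolding arc_dist_def by blast
qed

lemma arc_dist_0_iff: "u < K \<Longrightarrow> v < K \<Longrightarrow> arc_dist K u v = 0 \<longleftrightarrow> u = v"
  unfolding arc_dist_def cyc_arc_def min_def by (auto split: if_splits)

text \<open>The step follows the shorter of the two arcs. Iterating it yields a path of length
  \<open>arc_dist\<close>.\<close>

lemma arc_dist_step:
  assumes "u < K" "v < K" "arc_dist K u v = Suc n"
  shows "\<exists>w. cycle_adj K u w \<and> arc_dist K w v = n"
proof (cases "cyc_arc K u v \<le> K - cyc_arc K u v")
  case True
  define w where "w = (u + 1) mod K"
  have "w < K" using assms unfolding w_def by auto
  then have "cycle_adj K u w"
    using assms by (auto simp: w_def cycle_adj_def)
  moreover have "arc_dist K w v = n"
    using True assms arc_succ[of u K v] arc_less[OF \<open>w < K\<close> \<open>v < K\<close>]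
    unfolding arc_dist_def w_def[symmetric] by (simp split: if_splits)
  ultimately show ?thesis by blast
next
  case False
  define w where "w = (if u = 0 then K - 1 else u - 1)"
  have "w < K" using assms unfolding w_def by auto
  have u: "u = (w + 1) mod K" using assms by (auto simp: w_def)
  have "cycle_adj K u w"
    using assms(1) \<open>w < K\<close> u by (simp add: cycle_adj_def)
  moreover have "arc_dist K w v = n"
    using False assms arc_succ[of w K v] arc_less[OF \<open>u < K\<close> \<open>v < K\<close>] \<open>w < K\<close>
    unfolding arc_dist_def u[symmetric] by (simp split: if_splits; linarith)
  ultimately show ?thesis by blast
qed

lemma cycle_dist_eq_arc_dist:
  assumes "u < K" "v < K"
  shows "cycle_dist K u v = arc_dist K u v"
proof -
  have reach: "(cycle_adj K ^^ n) u v" if "u < K" "arc_dist K u v = n" for u n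
    using that
  proof (induction n arbitrary: u)
    case 0
    then show ?case using arc_dist_0_iff assms by auto
  next
    case (Suc n)
    then obtain w where w: "cycle_adj K u w" "arc_dist K w v = n"
      using arc_dist_step assms by blast
    with Suc.IH[of w] cycle_adj_less[OF w(1)] show ?case
      by (intro relpowp_Suc_I2[of "cycle_adj K" u w]) auto
  qed
  have lower: "arc_dist K u v \<le> n" if "(cycle_adj K ^^ n) u v" "u < K" for u n
    using that
  proof (induction n arbitrary: u)
    case 0
    then show ?case using arc_dist_0_iff[of v K v] assms by auto
  next
    case (Suc n)
    obtain w where w: "cycle_adj K u w" "(cycle_adj K ^^ n) w v"
      using Suc.prems(1) by (rule relpowp_Suc_E2)
    with Suc.IH[of w] cycle_adj_less[OF w(1)] arc_dist_adj[of K u w v] assms show ?case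
      by auto
  qed
  show ?thesis unfolding cycle_dist_def
    by (rule Least_equality) (use reach lower assms in auto)
qed

text \<open>Here \<open>a\<close> is the arc from a node to a destination, and \<open>b\<close>,
  \<open>b'\<close> are the arcs from two neighbours that are both nearer. If these differ, both
  ways around the cycle have length \<open>n + 1\<close>, which forces
  \<open>K = n + n + 2\<close>.\<close>

lemma two_nearer:
  fixes a b b' K n :: nat
  assumes "a < K" "b < K" "b' < K" and K: "K \<noteq> n + n + 2"
    and n: "min a (K - a) = Suc n" "min b (K - b) = n" "min b' (K - b') = n"
    and ab: "a = (if b = K - 1 then 0 else b + 1) \<or> b = (if a = K - 1 then 0 else a + 1)"
        "a = (if b' = K - 1 then 0 else b' + 1) \<or> b' = (if a = K - 1 then 0 else a + 1)"
  shows "b' = b"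
proof -
  have m: "(x = m \<and> x + m \<le> K) \<or> (x + m = K \<and> m \<le> x)" if "min x (K - x) = m" "x < K" for x m :: nat
    using that by (auto simp: min_def split: if_splits)
  have a: "a = n + 1 \<and> a + n + 1 \<le> K \<or> a + n + 1 = K \<and> n + 1 \<le> a"
    using m[OF n(1) assms(1)] by simp
  have step: "a = y + 1 \<or> y = a + 1 \<or> (y = 0 \<and> a + 1 = K)"
    if "a = (if y = K - 1 then 0 else y + 1) \<or> y = (if a = K - 1 then 0 else a + 1)" for y
    using that a by (auto split: if_splits)
  have y: "y = n \<and> a = n + 1 \<or> a + n + 1 = K \<and> (y + n = K \<or> n = 0 \<and> y = 0)"
    if "min y (K - y) = n" "y < K" "a = y + 1 \<or> y = a + 1 \<or> (y = 0 \<and> a + 1 = K)" for y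
    using that(3)
  proof (elim disjE conjE)
    assume "a = y + 1" then show ?thesis using m[OF that(1,2)] a K by linarith
  next
    assume "y = a + 1" then show ?thesis using m[OF that(1,2)] a K by linarith
  next
    assume "y = 0" "a + 1 = K" then show ?thesis using m[OF that(1,2)] a K by linarith
  qed
  have "b = n \<and> a = n + 1 \<or> a + n + 1 = K \<and> (b + n = K \<or> n = 0 \<and> b = 0)"
    using y[OF n(2) assms(2) step[OF ab(1)]] .
  moreover have "b' = n \<and> a = n + 1 \<or> a + n + 1 = K \<and> (b' + n = K \<or> n = 0 \<and> b' = 0)"
    using y[OF n(3) assms(3) step[OF ab(2)]] .
  ultimately show ?thesis using K assms(2,3) by linarith
qed

lemma next_hop:
  assumes "odd K" "u < K" "d < K" "u \<noteq> d"
  shows "cycle_adj K u (next_hop K u d)"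
proof -
  obtain n where n: "arc_dist K u d = Suc n"
    using arc_dist_0_iff[of u K d] assms not0_implies_Suc by blast
  obtain w where w: "cycle_adj K u w" "arc_dist K w d = n"
    using arc_dist_step[OF _ _ n] assms by blast
  have wK: "w < K" using w cycle_adj_less by blast
  text \<open>As \<open>K\<close> is odd, both neighbours can be closer to \<open>d\<close> only if \<open>K\<close> is twice the arc.\<close>
  have uniq: "w' = w" if w': "cycle_adj K u w'" "arc_dist K w' d = n" for w'
  proof -
    have w'K: "w' < K" using that cycle_adj_less by blast
    have K: "K \<noteq> n + n + 2" using \<open>odd K\<close> by auto
    have "cyc_arc K u d < K" "cyc_arc K w d < K" "cyc_arc K w' d < K"
      using assms wK w'K by (auto intro: arc_less)
    then have "cyc_arc K w' d = cyc_arc K w d"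
      using two_nearer[of "cyc_arc K u d" K "cyc_arc K w d" "cyc_arc K w' d" n]
        arc_adj[OF w(1) \<open>d < K\<close>] arc_adj[OF w'(1) \<open>d < K\<close>] n w(2) w'(2) K
      unfolding arc_dist_def by blast
    then show ?thesis using arc_inj w'K wK \<open>d < K\<close> by blast
  qed
  have "next_hop K u d = w"
    unfolding next_hop_def
  proof (rule the_equality)
    show "cycle_adj K u w \<and> cycle_dist K w d + 1 = cycle_dist K u d"
      using w n wK assms by (simp add: cycle_dist_eq_arc_dist)
    fix w' assume w': "cycle_adj K u w' \<and> cycle_dist K w' d + 1 = cycle_dist K u d"
    then have "w' < K" using cycle_adj_less by blast
    then show "w' = w" using w' n assms by (intro uniq) (auto simp: cycle_dist_eq_arc_dist)
  qed
  then show ?thesis using w by simp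
qed

lemma next_hop_less:
  assumes "odd K" "3 \<le> K" "u < K" "d < K" "u \<noteq> d"
  shows "next_hop K u d < K" "next_hop K u d \<noteq> u"
proof -
  have adj: "cycle_adj K u (next_hop K u d)" using next_hop assms by simp
  show "next_hop K u d < K" using adj cycle_adj_less by blast
  show "next_hop K u d \<noteq> u"
    using adj \<open>3 \<le> K\<close> Suc_mod_cycle[OF \<open>u < K\<close>] unfolding cycle_adj_def by (auto split: if_splits)
qed

text \<open>Customers leave only from their destination and its two neighbours: the origin of the 3
  in all later bounds.\<close>

lemma card_cycle_dist_gt_1:
  assumes "d < K"
  shows "K - 3 \<le> card {a. a < K \<and> 1 < cycle_dist K a d}"
proof -
  define B where "B = {d, if d = K - 1 then 0 else d + 1, if d = 0 then K - 1 else d - 1}"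
  have "{..<K} - B \<subseteq> {a. a < K \<and> 1 < cycle_dist K a d}"
  proof
    fix a assume "a \<in> {..<K} - B"
    then have "a < K" "\<not> arc_dist K a d \<le> 1"
      using assms unfolding arc_dist_def cyc_arc_def min_def B_def by (auto split: if_splits)
    then show "a \<in> {a. a < K \<and> 1 < cycle_dist K a d}"
      using assms by (simp add: cycle_dist_eq_arc_dist)
  qed
  then have "card ({..<K} - B) \<le> card {a. a < K \<and> 1 < cycle_dist K a d}"
    by (intro card_mono) auto
  moreover have "card {..<K} - card B \<le> card ({..<K} - B)"
    by (rule diff_card_le_card_Diff) (simp add: B_def)
  moreover have "card B \<le> 3"
    unfolding B_def by (auto simp: card_insert_if)
  ultimately show ?thesis by (simp only: card_lessThan)
qed

section \<open>The uniformized chain\<close>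

datatype clock = Arrival nat nat | Service nat | Swap nat

locale mobile_queues =
  fixes K :: nat and arr :: "nat \<Rightarrow> nat \<Rightarrow> real" and lam \<beta> :: real
  assumes odd_K: "odd K" and K_ge_3: "3 \<le> K"
    and lam_pos: "0 < lam" and beta_pos: "0 < \<beta>"
    and arr: "arrival_rates K lam arr"
begin

abbreviation succ :: "nat \<Rightarrow> nat" where "succ u \<equiv> Suc u mod K"

abbreviation flip :: "nat \<Rightarrow> nat \<Rightarrow> nat" where "flip u \<equiv> Transposition.transpose u (succ u)"

definition clocks :: "clock set" where
  "clocks = (\<lambda>(v, w). Arrival v w) ` ({..<K} \<times> {..<K}) \<union> Service ` {..<K} \<union> Swap ` {..<K}"

primrec ring_rate :: "clock \<Rightarrow> real" where
  "ring_rate (Arrival v w) = arr v w"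
| "ring_rate (Service v) = 1"
| "ring_rate (Swap u) = \<beta>"

primrec act :: "clock \<Rightarrow> queues \<Rightarrow> queues" where
  "act (Arrival v w) s = enqueue v w s"
| "act (Service v) s = serve K v s"
| "act (Swap u) s = swap_queues u (succ u) s"

primrec relocate :: "clock \<Rightarrow> nat \<Rightarrow> nat" where
  "relocate (Arrival v w) p = p"
| "relocate (Service v) p = p"
| "relocate (Swap u) p = flip u p"

text \<open>The uniformization rate: services at empty queues are counted too, so that the clocks
  ring at a total rate independent of the state.\<close>

definition total :: real where
  "total = K * lam + K + K * \<beta>"

text \<open>
  One step of the uniformized chain in which a server is followed: \<open>f\<close> is a function of the state
  and of the location of that server.
\<close>

definition mean :: "(queues \<Rightarrow> nat \<Rightarrow> real) \<Rightarrow> queues \<Rightarrow> nat \<Rightarrow> real" where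
  "mean f s p = (\<Sum>e\<in>clocks. ring_rate e * f (act e s) (relocate e p)) / total"

lemma total_pos: "0 < total"
  using lam_pos beta_pos K_ge_3 unfolding total_def by (simp add: add_pos_pos)

lemma arr_nonneg: "v < K \<Longrightarrow> w < K \<Longrightarrow> 0 \<le> arr v w"
  using arr unfolding arrival_rates_def by blast

lemma sum_arr: "v < K \<Longrightarrow> (\<Sum>w<K. arr v w) = lam"
  using arr unfolding arrival_rates_def by blast

lemma finite_clocks [simp]: "finite clocks"
  by (simp add: clocks_def)

lemma sum_clocks:
  "(\<Sum>e\<in>clocks. F e) =
    (\<Sum>v<K. \<Sum>w<K. F (Arrival v w)) + (\<Sum>v<K. F (Service v)) + (\<Sum>u<K. F (Swap u))"
  for F :: "clock \<Rightarrow> 'b::comm_monoid_add"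
proof -
  have "(\<Sum>e\<in>clocks. F e) = (\<Sum>e\<in>(\<lambda>(v, w). Arrival v w) ` ({..<K} \<times> {..<K}). F e)
    + (\<Sum>e\<in>Service ` {..<K}. F e) + (\<Sum>e\<in>Swap ` {..<K}. F e)"
  proof -
    have *: "(\<Sum>e\<in>A \<union> B \<union> C. F e) = (\<Sum>e\<in>A. F e) + (\<Sum>e\<in>B. F e) + (\<Sum>e\<in>C. F e)"
      if "finite A" "finite B" "finite C" "A \<inter> B = {}" "A \<inter> C = {}" "B \<inter> C = {}" for A B C
      using that by (simp add: sum.union_disjoint Int_Un_distrib2)
    show ?thesis unfolding clocks_def by (rule *) auto
  qed
  moreover have "(\<Sum>e\<in>(\<lambda>(v, w). Arrival v w) ` ({..<K} \<times> {..<K}). F e)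
    = (\<Sum>v<K. \<Sum>w<K. F (Arrival v w))"
    by (subst sum.reindex) (auto simp: inj_on_def sum.cartesian_product case_prod_unfold)
  moreover have "(\<Sum>e\<in>Service ` {..<K}. F e) = (\<Sum>v<K. F (Service v))"
    by (subst sum.reindex) (auto simp: inj_on_def)
  moreover have "(\<Sum>e\<in>Swap ` {..<K}. F e) = (\<Sum>u<K. F (Swap u))"
    by (subst sum.reindex) (auto simp: inj_on_def)
  ultimately show ?thesis by simp
qed

lemma ring_rate_nonneg: "e \<in> clocks \<Longrightarrow> 0 \<le> ring_rate e"
  using beta_pos arr_nonneg unfolding clocks_def by auto

lemma sum_ring_rate: "(\<Sum>e\<in>clocks. ring_rate e) = total"
  by (simp add: sum_clocks sum_arr total_def)

lemma network_rate_eq: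
  "network_rate K arr \<beta> s t = (\<Sum>e\<in>clocks. ring_rate e * of_bool (act e s = t))"
  by (simp add: network_rate_def sum_clocks)

lemma succ_less [simp]: "succ u < K"
  using K_ge_3 by simp

lemma relocate_less [simp]: "e \<in> clocks \<Longrightarrow> p < K \<Longrightarrow> relocate e p < K"
  unfolding clocks_def using K_ge_3 by (auto simp: Transposition.transpose_def)

lemma bij_relocate:
  assumes "e \<in> clocks"
  shows "bij_betw (relocate e) {..<K} {..<K}"
proof -
  have "relocate e (relocate e x) = x" for x by (cases e) auto
  then show ?thesis
    using relocate_less[OF assms] by (intro bij_betw_byWitness[of _ "relocate e"]) auto
qed

lemma network_states_nth:
  "s \<in> network_states K \<Longrightarrow> p < K \<Longrightarrow> set (s ! p) \<subseteq> {..<K}"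
  unfolding network_states_def by auto

lemma network_statesI:
  "length s = K \<Longrightarrow> (\<And>p. p < K \<Longrightarrow> set (s ! p) \<subseteq> {..<K}) \<Longrightarrow> s \<in> network_states K"
  by (simp add: network_states_def all_set_conv_all_nth)

lemma length_state [simp]: "s \<in> network_states K \<Longrightarrow> length s = K"
  unfolding network_states_def by auto

definition hop :: "nat \<Rightarrow> nat \<Rightarrow> nat \<Rightarrow> real" where
  "hop a b d = of_bool (1 < cycle_dist K a d \<and> next_hop K a d = b)"

lemma cycle_dist_gt_1_neq: "a < K \<Longrightarrow> 1 < cycle_dist K a d \<Longrightarrow> a \<noteq> d"
  by (auto simp: cycle_dist_eq_arc_dist arc_dist_def cyc_arc_def)

lemma hop_self [simp]: "a < K \<Longrightarrow> d < K \<Longrightarrow> hop a a d = 0"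
  using next_hop_less(2)[OF odd_K K_ge_3] cycle_dist_gt_1_neq unfolding hop_def by auto

lemma nth_enqueue:
  "s \<in> network_states K \<Longrightarrow> p < K \<Longrightarrow> enqueue v w s ! p = (if p = v then s ! p @ [w] else s ! p)"
  by (simp add: enqueue_def nth_list_update)

lemma nth_serve:
  assumes s: "s \<in> network_states K" and "v < K" "p < K"
  shows "serve K v s ! p = (if s ! v = [] then s ! p
    else (if p = v then tl (s ! p) else s ! p) @ (if hop v p (hd (s ! v)) = 1 then [hd (s ! v)] else []))"
proof (cases "s ! v")
  case (Cons d ds)
  have "d < K" using network_states_nth[OF s \<open>v < K\<close>] Cons by auto
  then have "next_hop K v d < K \<and> next_hop K v d \<noteq> v" if "\<not> cycle_dist K v d \<le> 1"
    using next_hop_less[OF odd_K K_ge_3 \<open>v < K\<close>] that cycle_dist_gt_1_neq[OF \<open>v < K\<close>] by simp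
  then show ?thesis
    using assms Cons by (simp add: serve_def hop_def enqueue_def nth_list_update)
qed (simp add: serve_def)

text \<open>A queue travels with its server, so a swap leaves the queue of a followed server
  unchanged.\<close>

lemma nth_swap_queues:
  assumes "s \<in> network_states K" "u < K" "p < K"
  shows "swap_queues u (succ u) s ! flip u p = s ! p"
  using assms by (simp add: swap_queues_def Transposition.transpose_def nth_list_update)

lemma act_network_states:
  assumes "e \<in> clocks" "s \<in> network_states K"
  shows "act e s \<in> network_states K"
proof (rule network_statesI)
  show "length (act e s) = K"
    using assms(2) by (cases e) (auto simp: enqueue_def serve_def swap_queues_def split: list.split)
  fix p assume p: "p < K"
  note sub = network_states_nth[OF assms(2)]
  from assms(1) consider
    (a) v w where "e = Arrival v w" "v < K" "w < K" | (b) v where "e = Service v" "v < K"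
    | (c) u where "e = Swap u" "u < K"
    unfolding clocks_def by auto
  then show "set (act e s ! p) \<subseteq> {..<K}"
  proof cases
    case a
    then show ?thesis using sub[OF p] p assms by (auto simp: nth_enqueue)
  next
    case b
    have "set (tl (s ! p)) \<subseteq> {..<K}" using sub[OF p] by (cases "s ! p") auto
    then show ?thesis
      using sub[OF p] sub[OF \<open>v < K\<close>] b p assms by (auto simp: nth_serve subset_iff)
  next
    case c
    have "flip u p < K" using relocate_less[OF assms(1) p] c by simp
    then show ?thesis
      using nth_swap_queues[OF assms(2) \<open>u < K\<close>, of "flip u p"] sub c by simp
  qed
qed

section \<open>Drift of the queue of a followed server\<close>

definition queue_length :: "queues \<Rightarrow> nat \<Rightarrow> real" where
  "queue_length s p = length (s ! p)"

definition inflow :: "queues \<Rightarrow> nat \<Rightarrow> real" where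
  "inflow s p = (\<Sum>a\<in>{..<K} - {p}. hop a p (hd (s ! a)))"

text \<open>Arrivals contribute \<open>lam\<close>, the server's own service -1, services elsewhere
  the inflow, and swaps nothing. Nonempty queues make every service effective and give
  \<open>hd\<close> its meaning.\<close>

lemma mean_queue_length:
  assumes s: "s \<in> network_states K" and ne: "\<And>a. a < K \<Longrightarrow> s ! a \<noteq> []" and p: "p < K"
  shows "mean queue_length s p - queue_length s p = (lam - 1 + inflow s p) / total"
proof -
  let ?l = "queue_length s p"
  have A: "(\<Sum>v<K. \<Sum>w<K. arr v w * queue_length (enqueue v w s) p) = K * lam * ?l + lam"
  proof -
    have "(\<Sum>v<K. \<Sum>w<K. arr v w * queue_length (enqueue v w s) p)
      = (\<Sum>v<K. (\<Sum>w<K. arr v w) * (?l + of_bool (v = p)))"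
      unfolding sum_distrib_right
      by (intro sum.cong refl) (use s p in \<open>auto simp: queue_length_def nth_enqueue\<close>)
    also have "\<dots> = (\<Sum>v<K. lam * ?l + (if v = p then lam else 0))"
      by (intro sum.cong) (auto simp: sum_arr algebra_simps)
    finally show ?thesis using p by (simp add: sum.distrib)
  qed
  have S: "(\<Sum>v<K. queue_length (serve K v s) p) = K * ?l - 1 + inflow s p"
  proof -
    have "queue_length (serve K v s) p = ?l + (if v = p then -1 else 0) + hop v p (hd (s ! v))"
      if "v < K" for v
      using nth_serve[OF s that p] ne[OF that]
      by (cases "s ! v") (auto simp: queue_length_def hop_def)
    then have "(\<Sum>v<K. queue_length (serve K v s) p)
      = (\<Sum>v<K. ?l + (if v = p then -1 else 0) + hop v p (hd (s ! v)))"
      by simp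
    also have "\<dots> = K * ?l - 1 + (\<Sum>v<K. hop v p (hd (s ! v)))"
      using p by (simp add: sum.distrib)
    also have "(\<Sum>v<K. hop v p (hd (s ! v))) = inflow s p"
    proof -
      have "hd (s ! p) < K"
        using network_states_nth[OF s p] ne[OF p] by (auto simp: subset_iff)
      then show ?thesis unfolding inflow_def using p by (simp add: sum.remove[of "{..<K}" p])
    qed
    finally show ?thesis .
  qed
  have W: "(\<Sum>u<K. \<beta> * queue_length (swap_queues u (succ u) s) (flip u p)) = K * \<beta> * ?l"
    using s p by (simp add: queue_length_def nth_swap_queues)
  have "mean queue_length s p = (K * lam * ?l + lam + (K * ?l - 1 + inflow s p) + K * \<beta> * ?l) / total"
    unfolding mean_def sum_clocks using A S W by simp
  also have "\<dots> = (total * ?l + (lam - 1 + inflow s p)) / total"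
    by (simp add: total_def algebra_simps)
  finally show ?thesis using total_pos by (simp add: field_simps)
qed

text \<open>
  \<open>hop_prob k L a b\<close>: for two servers located at \<open>a\<close> and \<open>b\<close>, the first of them with queue \<open>L\<close> of
  length more than \<open>k\<close>, the probability that after \<open>k\<close> steps of the uniformized chain a service at
  the first one would send its customer to the second one.
\<close>

primrec hop_prob :: "nat \<Rightarrow> nat list \<Rightarrow> nat \<Rightarrow> nat \<Rightarrow> real" where
  "hop_prob 0 L a b = hop a b (hd L)"
| "hop_prob (Suc k) L a b = ((K * lam + (K - 1)) * hop_prob k L a b + hop_prob k (tl L) a b
     + \<beta> * (\<Sum>u<K. hop_prob k L (flip u a) (flip u b))) / total"

text \<open>At most \<open>k\<close> customers are removed in \<open>k\<close> steps, so only the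
  first \<open>k + 1\<close> entries matter.\<close>

lemma hop_prob_append: "k < length L \<Longrightarrow> hop_prob k (L @ M) a b = hop_prob k L a b"
proof (induction k arbitrary: L a b)
  case (Suc k)
  then have "L \<noteq> []" by auto
  with Suc show ?case by simp
qed auto

text \<open>The expectation closes on single queues. For a fixed server, arrivals and the
  \<open>K - 1\<close> services elsewhere at most append to its queue, which \<open>hop_prob\<close>
  does not see; its own service drops the head; a swap moves both locations. These are the three
  terms in the recursion of \<open>hop_prob\<close>.\<close>

lemma mean_pow_inflow:
  assumes "s \<in> network_states K" "\<And>a. a < K \<Longrightarrow> k < length (s ! a)" "p < K"
  shows "(mean ^^ k) inflow s p = (\<Sum>a\<in>{..<K} - {p}. hop_prob k (s ! a) a p)"
  using assms
proof (induction k arbitrary: s p)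
  case 0
  then show ?case by (simp add: inflow_def)
next
  case (Suc k)
  note s = \<open>s \<in> network_states K\<close> and p = \<open>p < K\<close>
  have len: "Suc k < length (s ! a)" if "a < K" for a using Suc.prems(2) that .
  let ?F = "(mean ^^ k) inflow" and ?A = "{..<K} - {p}"
  have A: "?F (enqueue v w s) p = (\<Sum>a\<in>?A. hop_prob k (s ! a) a p)" if "v < K" "w < K" for v w
  proof -
    have e: "Arrival v w \<in> clocks" using that by (auto simp: clocks_def)
    have "enqueue v w s \<in> network_states K" using act_network_states[OF e s] by simp
    moreover have "k < length (enqueue v w s ! a)" if "a < K" for a
      using len[OF that] s that by (auto simp: nth_enqueue)
    ultimately have "?F (enqueue v w s) p = (\<Sum>a\<in>?A. hop_prob k (enqueue v w s ! a) a p)"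
      by (rule Suc.IH) (use p in auto)
    also have "\<dots> = (\<Sum>a\<in>?A. hop_prob k (s ! a) a p)"
    proof (rule sum.cong)
      fix a assume "a \<in> ?A"
      then show "hop_prob k (enqueue v w s ! a) a p = hop_prob k (s ! a) a p"
        using len[of a] s hop_prob_append[of k "s ! a"] by (auto simp: nth_enqueue)
    qed simp
    finally show ?thesis .
  qed
  have S: "?F (serve K v s) p = (\<Sum>a\<in>?A. hop_prob k (if a = v then tl (s ! a) else s ! a) a p)"
    if v: "v < K" for v
  proof -
    have e: "Service v \<in> clocks" using that by (auto simp: clocks_def)
    have "s ! v \<noteq> []" using len[OF v] by auto
    note nth = nth_serve[OF s v, unfolded if_not_P[OF this]]
    have "serve K v s \<in> network_states K" using act_network_states[OF e s] by simp
    moreover have "k < length (serve K v s ! a)" if "a < K" for a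
      using len[OF that] nth[OF that] by auto
    ultimately have "?F (serve K v s) p = (\<Sum>a\<in>?A. hop_prob k (serve K v s ! a) a p)"
      by (rule Suc.IH) (use p in auto)
    also have "\<dots> = (\<Sum>a\<in>?A. hop_prob k (if a = v then tl (s ! a) else s ! a) a p)"
    proof (rule sum.cong)
      fix a assume a: "a \<in> ?A"
      have "k < length (if a = v then tl (s ! a) else s ! a)" using len[of a] a by auto
      then show "hop_prob k (serve K v s ! a) a p = hop_prob k (if a = v then tl (s ! a) else s ! a) a p"
        using nth[of a] a hop_prob_append by simp
    qed simp
    finally show ?thesis .
  qed
  have W: "?F (swap_queues u (succ u) s) (flip u p)
    = (\<Sum>a\<in>?A. hop_prob k (s ! a) (flip u a) (flip u p))" if u: "u < K" for u
  proof -
    let ?t = "flip u"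
    have e: "Swap u \<in> clocks" using that by (auto simp: clocks_def)
    have tK: "?t a < K" if "a < K" for a using relocate_less[OF e that] by simp
    note nth = nth_swap_queues[OF s u]
    have "swap_queues u (succ u) s \<in> network_states K" using act_network_states[OF e s] by simp
    moreover have "k < length (swap_queues u (succ u) s ! a)" if "a < K" for a
      using nth[of "?t a"] len[of "?t a"] tK[OF that] by simp
    ultimately have "?F (swap_queues u (succ u) s) (?t p)
      = (\<Sum>a\<in>{..<K} - {?t p}. hop_prob k (swap_queues u (succ u) s ! a) a (?t p))"
      by (rule Suc.IH) (use tK p in auto)
    also have "\<dots> = (\<Sum>a\<in>?A. hop_prob k (s ! a) (?t a) (?t p))"
    \<comment> \<open>The sum over locations after the swap is reindexed by the locations of the
      same servers before it.\<close>
    proof (rule sum.reindex_bij_witness[of _ ?t ?t])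
      fix a assume a: "a \<in> {..<K} - {?t p}"
      show "?t (?t a) = a" by simp
      have "?t a \<noteq> p" using a by auto
      then show "?t a \<in> ?A" using a tK by simp
      show "hop_prob k (s ! ?t a) (?t (?t a)) (?t p) = hop_prob k (swap_queues u (succ u) s ! a) a (?t p)"
        using nth[of "?t a"] tK a by simp
    next
      fix b assume b: "b \<in> ?A"
      show "?t (?t b) = b" by simp
      have "?t b \<noteq> ?t p" using b by (metis DiffD2 insertI1 transpose_involutory)
      then show "?t b \<in> {..<K} - {?t p}" using b tK by simp
    qed
    finally show ?thesis .
  qed
  have SS: "(\<Sum>v<K. hop_prob k (if a = v then tl (s ! a) else s ! a) a p)
      = (K - 1) * hop_prob k (s ! a) a p + hop_prob k (tl (s ! a)) a p" if "a < K" for a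
  proof -
    have "(\<Sum>v<K. hop_prob k (if a = v then tl (s ! a) else s ! a) a p)
      = (\<Sum>v\<in>{..<K} - {a}. hop_prob k (s ! a) a p) + hop_prob k (tl (s ! a)) a p"
      using that by (subst sum.remove[of _ a]) (auto intro!: sum.cong)
    then show ?thesis using that by simp
  qed
  have "(mean ^^ Suc k) inflow s p = mean ?F s p" by simp
  also have "\<dots> = ((\<Sum>v<K. \<Sum>w<K. arr v w * (\<Sum>a\<in>?A. hop_prob k (s ! a) a p))
    + (\<Sum>v<K. \<Sum>a\<in>?A. hop_prob k (if a = v then tl (s ! a) else s ! a) a p)
    + (\<Sum>u<K. \<beta> * (\<Sum>a\<in>?A. hop_prob k (s ! a) (flip u a) (flip u p)))) / total"
    unfolding mean_def[of ?F] sum_clocks using A S W by simp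
  also have "(\<Sum>v<K. \<Sum>w<K. arr v w * (\<Sum>a\<in>?A. hop_prob k (s ! a) a p))
    = (\<Sum>a\<in>?A. K * lam * hop_prob k (s ! a) a p)"
    unfolding sum_distrib_right[symmetric] sum_distrib_left[symmetric] by (simp add: sum_arr)
  also have "(\<Sum>v<K. \<Sum>a\<in>?A. hop_prob k (if a = v then tl (s ! a) else s ! a) a p)
    = (\<Sum>a\<in>?A. (K - 1) * hop_prob k (s ! a) a p + hop_prob k (tl (s ! a)) a p)"
    by (subst sum.swap) (simp add: SS)
  also have "(\<Sum>u<K. \<beta> * (\<Sum>a\<in>?A. hop_prob k (s ! a) (flip u a) (flip u p)))
    = (\<Sum>a\<in>?A. \<beta> * (\<Sum>u<K. hop_prob k (s ! a) (flip u a) (flip u p)))"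
    unfolding sum_distrib_left by (rule sum.swap)
  finally show ?case
    by (simp add: sum.distrib[symmetric] sum_divide_distrib algebra_simps)
qed

section \<open>Mixing of the locations of two servers\<close>

definition pairs :: "(nat \<times> nat) set" where
  "pairs = (SIGMA a:{..<K}. {..<K} - {a})"

lemma finite_pairs [simp]: "finite pairs"
  by (simp add: pairs_def)

lemma card_pairs: "card pairs = K * (K - 1)"
  by (simp add: pairs_def card_Diff_singleton)

lemma flip_less [simp]: "u < K \<Longrightarrow> a < K \<Longrightarrow> flip u a < K"
  by (simp add: Transposition.transpose_def)

lemma flip_pairs [simp]: "u < K \<Longrightarrow> (a, b) \<in> pairs \<Longrightarrow> (flip u a, flip u b) \<in> pairs"
  unfolding pairs_def by auto (metis transpose_involutory)

lemma set_tl_subset: "set L \<subseteq> A \<Longrightarrow> set (tl L) \<subseteq> A"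
  by (cases L) auto

lemma hop_prob_nonneg: "0 \<le> hop_prob k L a b"
proof (induction k arbitrary: L a b)
  case (Suc k)
  then show ?case
    using lam_pos beta_pos total_pos K_ge_3
    by (auto intro!: divide_nonneg_pos add_nonneg_nonneg mult_nonneg_nonneg sum_nonneg)
qed (simp add: hop_def)

text \<open>At the start each of the at least \<open>K - 3\<close> locations far from the
  destination sends its customer to exactly one other node. The bound persists: swaps permute
  \<open>pairs\<close>, and a service passes to \<open>tl L\<close>, which satisfies the same bound
  by induction.\<close>

lemma sum_hop_prob:
  assumes "k < length L" "set L \<subseteq> {..<K}"
  shows "K - 3 \<le> (\<Sum>(a, b)\<in>pairs. hop_prob k L a b)"
  using assms
proof (induction k arbitrary: L)
  case 0
  let ?d = "hd L"
  have d: "?d < K" using 0 by (cases L) auto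
  have *: "(\<Sum>b\<in>{..<K} - {a}. hop a b ?d) = of_bool (1 < cycle_dist K a ?d)" if a: "a < K" for a
  proof (cases "1 < cycle_dist K a ?d")
    case True
    then have "next_hop K a ?d \<in> {..<K} - {a}"
      using next_hop_less[OF odd_K K_ge_3 a d] cycle_dist_gt_1_neq[OF a] by auto
    moreover have "hop a b ?d = (if b = next_hop K a ?d then 1 else 0)" for b
      using True by (auto simp: hop_def)
    ultimately show ?thesis using True by (simp add: sum.delta)
  qed (simp add: hop_def)
  have "(\<Sum>(a, b)\<in>pairs. hop_prob 0 L a b) = (\<Sum>a<K. \<Sum>b\<in>{..<K} - {a}. hop a b ?d)"
    unfolding pairs_def by (simp add: sum.Sigma)
  also have "\<dots> = card {a. a < K \<and> 1 < cycle_dist K a ?d}"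
    by (simp add: * Int_def del: One_nat_def)
  finally show ?case using card_cycle_dist_gt_1[OF d] by simp
next
  case (Suc k)
  have L: "K - 3 \<le> (\<Sum>(a, b)\<in>pairs. hop_prob k L a b)"
    using Suc by auto
  have tl: "K - 3 \<le> (\<Sum>(a, b)\<in>pairs. hop_prob k (tl L) a b)"
    using Suc.prems by (intro Suc.IH set_tl_subset) auto
  have flip: "(\<Sum>(a, b)\<in>pairs. hop_prob k L (flip u a) (flip u b)) = (\<Sum>(a, b)\<in>pairs. hop_prob k L a b)"
    if "u < K" for u
    by (rule sum.reindex_bij_witness[of _ "\<lambda>(a, b). (flip u a, flip u b)" "\<lambda>(a, b). (flip u a, flip u b)"])
       (use that in auto)
  let ?S = "\<Sum>(a, b)\<in>pairs. hop_prob k L a b" and ?T = "\<Sum>(a, b)\<in>pairs. hop_prob k (tl L) a b"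
  have "(\<Sum>(a, b)\<in>pairs. hop_prob (Suc k) L a b) = ((K * lam + (K - 1)) * ?S + ?T
    + \<beta> * (\<Sum>(a, b)\<in>pairs. \<Sum>u<K. hop_prob k L (flip u a) (flip u b))) / total"
    by (simp add: case_prod_unfold sum_divide_distrib[symmetric] sum.distrib sum_distrib_left)
  also have "(\<Sum>(a, b)\<in>pairs. \<Sum>u<K. hop_prob k L (flip u a) (flip u b)) = K * ?S"
    unfolding case_prod_unfold by (subst sum.swap) (use flip in \<open>simp add: case_prod_unfold\<close>)
  also have "((K * lam + (K - 1)) * (K - 3) + (K - 3) + \<beta> * (K * (K - 3))) / total
    \<le> ((K * lam + (K - 1)) * ?S + ?T + \<beta> * (K * ?S)) / total"
    using L tl lam_pos beta_pos total_pos K_ge_3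
    by (intro divide_right_mono add_mono mult_left_mono) auto
  moreover have "((K * lam + (K - 1)) * (K - 3) + (K - 3) + \<beta> * (K * (K - 3))) / total = K - 3"
    using total_pos K_ge_3 by (simp add: total_def field_simps of_nat_diff)
  ultimately show ?case by simp
qed

text \<open>The bound of \<open>sum_hop_prob\<close> divided by the number of ordered pairs. Summed
  over the \<open>K - 1\<close> possible sources of inflow, it gives
  \<open>1 - 3 / K\<close>.\<close>

definition avg :: real where
  "avg = (real K - 3) / (K * (K - 1))"

lemma avg_nonneg: "0 \<le> avg"
  using K_ge_3 by (simp add: avg_def)

lemma ex_hop_prob_ge_avg:
  assumes "k < length L" "set L \<subseteq> {..<K}"
  shows "\<exists>(a, b)\<in>pairs. avg \<le> hop_prob k L a b"
proof (rule ccontr)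
  assume "\<not> ?thesis"
  then have less: "hop_prob k L (fst x) (snd x) < avg" if "x \<in> pairs" for x
    using that by (auto simp: case_prod_unfold not_le)
  have "pairs \<noteq> {}" using card_pairs K_ge_3 by auto
  then have "(\<Sum>x\<in>pairs. hop_prob k L (fst x) (snd x)) < (\<Sum>x\<in>pairs. avg)"
    using less by (intro sum_strict_mono) auto
  also have "\<dots> = real K - 3"
    using K_ge_3 by (simp add: card_pairs avg_def of_nat_diff)
  finally show False using sum_hop_prob[OF assms] K_ge_3 by (simp add: case_prod_unfold of_nat_diff)
qed

text \<open>Steps of a pair of locations by one common swap. Including \<open>Id\<close> makes the
  powers of the relation increasing, so one exponent can serve all pairs.\<close>

definition moves :: "((nat \<times> nat) \<times> (nat \<times> nat)) set" where
  "moves = Id \<union> {((a, b), (flip u a, flip u b)) | a b u. u < K}"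

lemma moves_pairs: "(x, y) \<in> moves \<Longrightarrow> x \<in> pairs \<Longrightarrow> y \<in> pairs"
  unfolding moves_def by auto

text \<open>Swaps along edges generate all transpositions, and two transpositions carry any ordered
  pair of distinct nodes to any other.\<close>

lemma moves_connected:
  assumes "x \<in> pairs" "y \<in> pairs"
  shows "(x, y) \<in> moves\<^sup>*"
proof -
  \<comment> \<open>\<open>G\<close> collects the maps of locations that can be realized by moves on
    all pairs simultaneously; it is closed under composition.\<close>
  define G where "G = {g. \<forall>a b. ((a, b), (g a, g b)) \<in> moves\<^sup>*}"
  have comp: "g \<circ> h \<in> G" if "g \<in> G" "h \<in> G" for g h
    using that unfolding G_def by simp (metis rtrancl_trans)
  have flip: "flip u \<in> G" if "u < K" for u
    using that unfolding G_def moves_def by (auto intro!: r_into_rtrancl)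
  have le: "Transposition.transpose i j \<in> G" if "i \<le> j" "j < K" for i j
    using that
  proof (induction j rule: dec_induct)
    case base
    then show ?case by (simp add: G_def)
  next
    case (step j)
    then have j: "succ j = Suc j" by simp
    show ?case
    proof (cases "i = j")
      case True
      then show ?thesis using flip[of j] step j by simp
    next
      case False
      \<comment> \<open>Conjugating the transposition of \<open>i\<close> and \<open>j\<close> by
        the adjacent one moves \<open>j\<close> to \<open>Suc j\<close>.\<close>
      then have "Transposition.transpose i (Suc j) = flip j \<circ> (Transposition.transpose i j \<circ> flip j)"
        using step unfolding j by (auto simp: fun_eq_iff Transposition.transpose_def)
      moreover have "flip j \<circ> (Transposition.transpose i j \<circ> flip j) \<in> G"
        using step by (intro comp flip) auto
      ultimately show ?thesis by metis
    qed
  qed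
  have tr: "Transposition.transpose i j \<in> G" if "i < K" "j < K" for i j
    using le[of i j] le[of j i] that by (cases "i \<le> j") (auto simp: transpose_commute)
  obtain a b c d where xy: "x = (a, b)" "y = (c, d)" by fastforce
  \<comment> \<open>First \<open>a\<close> goes to \<open>c\<close>, which takes \<open>b\<close> to
    \<open>b'\<close>; then \<open>b'\<close> goes to \<open>d\<close>. The second transposition
    fixes \<open>c\<close> because neither \<open>b'\<close> nor \<open>d\<close> equals
    \<open>c\<close>.\<close>
  define b' where "b' = Transposition.transpose a c b"
  have b': "b' < K" "b' \<noteq> c"
    using assms unfolding xy pairs_def b'_def by (auto simp: Transposition.transpose_def split: if_splits)
  have "Transposition.transpose b' d \<circ> Transposition.transpose a c \<in> G"
    using assms b' by (intro comp tr) (auto simp: xy pairs_def)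
  moreover have "Transposition.transpose b' d (Transposition.transpose a c a) = c"
    "Transposition.transpose b' d (Transposition.transpose a c b) = d"
    using assms b' unfolding xy pairs_def b'_def[symmetric] by (auto simp: Transposition.transpose_def)
  ultimately show ?thesis unfolding G_def xy by (metis (mono_tags, lifting) comp_apply mem_Collect_eq)
qed

lemma ex_uniform_moves: "\<exists>N. \<forall>x\<in>pairs. \<forall>y\<in>pairs. (x, y) \<in> moves ^^ N"
proof -
  have mono: "(x, y) \<in> moves ^^ n" if "(x, y) \<in> moves ^^ m" "m \<le> n" for x y m n
    using that(2,1)
    by (induction rule: dec_induct) (auto simp: moves_def)
  have "eventually (\<lambda>n. (x, y) \<in> moves ^^ n) sequentially" if "x \<in> pairs" "y \<in> pairs" for x y
    using rtrancl_imp_relpow[OF moves_connected[OF that]] mono unfolding eventually_sequentially by blast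
  then have "eventually (\<lambda>n. \<forall>x\<in>pairs. \<forall>y\<in>pairs. (x, y) \<in> moves ^^ n) sequentially"
    by (intro eventually_ball_finite ballI) auto
  then show ?thesis by (auto simp: eventually_sequentially)
qed

text \<open>A lower bound for the probability of any single move while the queue in question is not
  served: a given swap has weight \<open>\<beta>\<close>, and the arrivals, which move nobody, have
  weight \<open>K * lam\<close>.\<close>

definition \<eta> :: real where
  "\<eta> = min \<beta> (K * lam) / total"

lemma eta: "0 < \<eta>" "\<eta> \<le> 1" "total * \<eta> \<le> \<beta>" "total * \<eta> \<le> K * lam + (K - 1)"
proof -
  show "0 < \<eta>" using lam_pos beta_pos K_ge_3 total_pos by (simp add: \<eta>_def)
  have eq: "total * \<eta> = min \<beta> (K * lam)" using total_pos by (simp add: \<eta>_def)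
  show "total * \<eta> \<le> \<beta>" "total * \<eta> \<le> K * lam + (K - 1)" unfolding eq by (auto simp: min_def)
  have "K * lam \<le> total" unfolding total_def using beta_pos by (simp add: mult_nonneg_nonneg)
  then show "\<eta> \<le> 1" unfolding \<eta>_def using total_pos by (simp add: min_le_iff_disj)
qed

text \<open>All successors, including the one after a service, are worth at least \<open>r\<close>,
  and the successor \<open>y\<close> has probability at least \<open>\<eta>\<close>; so an excess
  \<open>e\<close> at \<open>y\<close> is inherited up to the factor \<open>\<eta>\<close>.\<close>

lemma hop_prob_step:
  assumes r: "\<And>a b. (a, b) \<in> pairs \<Longrightarrow> r \<le> hop_prob k L a b"
      "\<And>a b. (a, b) \<in> pairs \<Longrightarrow> r \<le> hop_prob k (tl L) a b"
    and y: "(x, y) \<in> moves" "r + e \<le> hop_prob k L (fst y) (snd y)" and "0 \<le> e" and x: "x \<in> pairs"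
  shows "r + \<eta> * e \<le> hop_prob (Suc k) L (fst x) (snd x)"
proof -
  obtain a b where ab: "x = (a, b)" by fastforce
  have p: "(a, b) \<in> pairs" using x ab by simp
  let ?c = "K * lam + (K - 1)" and ?S = "\<Sum>u<K. hop_prob k L (flip u a) (flip u b)"
  have c: "0 \<le> ?c" using lam_pos K_ge_3 by simp
  \<comment> \<open>The three weights add up to \<open>total\<close>, so a constant lower bound
    reproduces itself.\<close>
  have tot: "total * r = ?c * r + r + \<beta> * (K * r)"
    using K_ge_3 by (simp add: total_def algebra_simps of_nat_diff)
  have num: "total * r + total * \<eta> * e \<le> ?c * hop_prob k L a b + hop_prob k (tl L) a b + \<beta> * ?S"
    using y(1) unfolding moves_def ab
  proof (elim UnE)
    assume "((a, b), y) \<in> Id"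
    then have "?c * (r + e) \<le> ?c * hop_prob k L a b"
      using y c by (intro mult_left_mono) auto
    moreover have "K * r \<le> ?S"
      using sum_mono[of "{..<K}" "\<lambda>_. r" "\<lambda>u. hop_prob k L (flip u a) (flip u b)"] r(1) p by simp
    then have "\<beta> * (K * r) \<le> \<beta> * ?S"
      using beta_pos by (intro mult_left_mono) auto
    moreover have "total * \<eta> * e \<le> ?c * e"
      using eta \<open>0 \<le> e\<close> by (intro mult_right_mono) auto
    ultimately show ?thesis
      using tot r(2)[OF p] by (simp add: algebra_simps)
  next
    assume "((a, b), y) \<in> {((a, b), (flip u a, flip u b)) | a b u. u < K}"
    then obtain u where u: "u < K" "y = (flip u a, flip u b)" by auto
    have "K * r + e = (\<Sum>v<K. r + (if v = u then e else 0))"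
      using u by (simp add: sum.distrib)
    also have "\<dots> \<le> ?S"
      using r(1) p y u by (intro sum_mono) auto
    finally have "\<beta> * (K * r + e) \<le> \<beta> * ?S"
      using beta_pos by (intro mult_left_mono) auto
    moreover have "?c * r \<le> ?c * hop_prob k L a b"
      using r(1)[OF p] c by (intro mult_left_mono) auto
    moreover have "total * \<eta> * e \<le> \<beta> * e"
      using eta \<open>0 \<le> e\<close> by (intro mult_right_mono) auto
    ultimately show ?thesis
      using tot r(2)[OF p] by (simp add: algebra_simps)
  qed
  then show ?thesis
    using total_pos unfolding ab by (simp add: pos_le_divide_eq algebra_simps)
qed

text \<open>Uniformity over all sufficiently long queues lets the bound survive a service, which
  replaces \<open>L\<close> by \<open>tl L\<close>.\<close>

definition hop_bound :: "nat \<Rightarrow> real \<Rightarrow> bool" where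
  "hop_bound k r \<longleftrightarrow> (\<forall>L a b. k < length L \<longrightarrow> set L \<subseteq> {..<K} \<longrightarrow> (a, b) \<in> pairs \<longrightarrow> r \<le> hop_prob k L a b)"

lemma hop_boundD:
  "hop_bound k r \<Longrightarrow> k < length L \<Longrightarrow> set L \<subseteq> {..<K} \<Longrightarrow> (a, b) \<in> pairs \<Longrightarrow> r \<le> hop_prob k L a b"
  unfolding hop_bound_def by blast

lemma hop_bound_Suc:
  assumes "hop_bound k r"
  shows "hop_bound (Suc k) r"
  unfolding hop_bound_def
proof (intro allI impI)
  fix L a b assume L: "Suc k < length L" "set L \<subseteq> {..<K}" "(a, b) \<in> pairs"
  have "r + \<eta> * 0 \<le> hop_prob (Suc k) L (fst (a, b)) (snd (a, b))"
  proof (rule hop_prob_step)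
    show "r \<le> hop_prob k L a b" if "(a, b) \<in> pairs" for a b
      using hop_boundD[OF assms] L that by simp
    show "r \<le> hop_prob k (tl L) a b" if "(a, b) \<in> pairs" for a b
      using hop_boundD[OF assms, of "tl L"] L that set_tl_subset[of L] by simp
    show "((a, b), (a, b)) \<in> moves" by (simp add: moves_def)
    show "r + 0 \<le> hop_prob k L (fst (a, b)) (snd (a, b))"
      using hop_boundD[OF assms] L by simp
  qed (use L in auto)
  then show "r \<le> hop_prob (Suc k) L a b" by simp
qed

lemma hop_bound_mono: "hop_bound k r \<Longrightarrow> k \<le> n \<Longrightarrow> hop_bound n r"
  by (rotate_tac 1, induction rule: dec_induct) (auto intro: hop_bound_Suc)

text \<open>Starting from a pair \<open>y\<close> without deficit, the excess \<open>c\<close> over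
  the uniform bound is carried back along the moves and loses a factor \<open>\<eta>\<close> each
  time.\<close>

lemma hop_prob_along_moves:
  assumes "hop_bound k (avg - c)" "0 \<le> c" "avg \<le> hop_prob k L (fst y) (snd y)"
    and "(x, y) \<in> moves ^^ j" "x \<in> pairs" "k + j < length L" "set L \<subseteq> {..<K}"
  shows "avg - c + \<eta> ^ j * c \<le> hop_prob (k + j) L (fst x) (snd x)"
  using assms(4-6)
proof (induction j arbitrary: x)
  case 0
  then show ?case using assms(3) by simp
next
  case (Suc j)
  obtain z where z: "(x, z) \<in> moves" "(z, y) \<in> moves ^^ j"
    using Suc.prems(1) by (rule relpow_Suc_E2)
  have b: "hop_bound (k + j) (avg - c)" using hop_bound_mono[OF assms(1)] by simp
  have "avg - c + \<eta> * (\<eta> ^ j * c) \<le> hop_prob (Suc (k + j)) L (fst x) (snd x)"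
  proof (rule hop_prob_step)
    show "avg - c \<le> hop_prob (k + j) L a b" if "(a, b) \<in> pairs" for a b
      using hop_boundD[OF b] Suc.prems assms(7) that by simp
    show "avg - c \<le> hop_prob (k + j) (tl L) a b" if "(a, b) \<in> pairs" for a b
      using hop_boundD[OF b, of "tl L"] Suc.prems assms(7) that set_tl_subset[of L] by simp
    show "(x, z) \<in> moves" by fact
    show "avg - c + \<eta> ^ j * c \<le> hop_prob (k + j) L (fst z) (snd z)"
      using Suc.IH[OF z(2)] moves_pairs[OF z(1)] Suc.prems by simp
    show "0 \<le> \<eta> ^ j * c" using eta assms(2) by simp
  qed (rule Suc.prems)
  then show ?case by (simp add: mult.assoc)
qed

text \<open>Doeblin's argument: for each queue some pair reaches \<open>avg\<close>, and every pair
  can be moved there in exactly \<open>N\<close> moves. That pair depends on the queue, so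
  \<open>N\<close> has to serve all targets.\<close>

lemma hop_bound_contraction:
  assumes N: "\<forall>x\<in>pairs. \<forall>y\<in>pairs. (x, y) \<in> moves ^^ N"
    and b: "hop_bound k (avg - c)" and c: "0 \<le> c"
  shows "hop_bound (k + N) (avg - (1 - \<eta> ^ N) * c)"
  unfolding hop_bound_def
proof (intro allI impI)
  fix L a b assume L: "k + N < length L" "set L \<subseteq> {..<K}" and ab: "(a, b) \<in> pairs"
  obtain y where y: "y \<in> pairs" "avg \<le> hop_prob k L (fst y) (snd y)"
    using ex_hop_prob_ge_avg[of k L] L by auto
  have "((a, b), y) \<in> moves ^^ N" using N ab y by blast
  then have "avg - c + \<eta> ^ N * c \<le> hop_prob (k + N) L (fst (a, b)) (snd (a, b))"
    by (rule hop_prob_along_moves[OF b c y(2)]) (use L ab in auto)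
  then show "avg - (1 - \<eta> ^ N) * c \<le> hop_prob (k + N) L a b"
    by (simp add: algebra_simps)
qed

lemma eventually_hop_bound:
  assumes "0 < \<epsilon>"
  shows "\<exists>k0. \<forall>k\<ge>k0. hop_bound k (avg - \<epsilon>)"
proof -
  obtain N where N: "\<forall>x\<in>pairs. \<forall>y\<in>pairs. (x, y) \<in> moves ^^ N"
    using ex_uniform_moves by blast
  define \<rho> where "\<rho> = 1 - \<eta> ^ N"
  have \<rho>: "0 \<le> \<rho>" "\<rho> < 1" using eta by (auto simp: \<rho>_def power_le_one)
  \<comment> \<open>The iteration starts with deficit \<open>avg\<close>, that is, with the trivial
    lower bound 0.\<close>
  have *: "hop_bound (i * N) (avg - \<rho> ^ i * avg)" for i
  proof (induction i)
    case 0
    then show ?case by (simp add: hop_bound_def hop_def)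
  next
    case (Suc i)
    show ?case
      using hop_bound_contraction[OF N Suc] \<rho> avg_nonneg
      by (simp add: \<rho>_def[symmetric] mult.assoc add.commute)
  qed
  have "(\<lambda>i. \<rho> ^ i * avg) \<longlonglongrightarrow> 0 * avg"
    using \<rho> by (intro tendsto_mult LIMSEQ_power_zero tendsto_const) auto
  then have "eventually (\<lambda>i. \<rho> ^ i * avg < \<epsilon>) sequentially"
    using assms by (intro order_tendstoD(2)) auto
  then obtain i where "\<rho> ^ i * avg < \<epsilon>" by (auto simp: eventually_sequentially)
  then have "hop_bound (i * N) (avg - \<epsilon>)"
    using *[of i] unfolding hop_bound_def by (meson diff_left_mono less_imp_le order_trans)
  then show ?thesis using hop_bound_mono by blast
qed

section \<open>Drift and the Lyapunov function\<close>

lemma mean_linear: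
  "mean (\<lambda>s p. c + d * f s p + d' * g s p) s p = c + d * mean f s p + d' * mean g s p"
proof -
  have "(\<Sum>e\<in>clocks. ring_rate e * (c + d * f (act e s) (relocate e p) + d' * g (act e s) (relocate e p)))
    = (\<Sum>e\<in>clocks. ring_rate e) * c + d * (\<Sum>e\<in>clocks. ring_rate e * f (act e s) (relocate e p))
      + d' * (\<Sum>e\<in>clocks. ring_rate e * g (act e s) (relocate e p))"
    by (simp add: sum.distrib sum_distrib_left sum_distrib_right algebra_simps)
  then show ?thesis
    using total_pos by (simp add: mean_def sum_ring_rate field_simps)
qed

lemma mean_pow_linear:
  "(mean ^^ k) (\<lambda>s p. c + d * f s p + d' * g s p) s p = c + d * (mean ^^ k) f s p + d' * (mean ^^ k) g s p"
proof (induction k arbitrary: s p)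
  case (Suc k)
  then have "(mean ^^ k) (\<lambda>s p. c + d * f s p + d' * g s p)
    = (\<lambda>s p. c + d * (mean ^^ k) f s p + d' * (mean ^^ k) g s p)"
    by (simp add: fun_eq_iff)
  then show ?case by (simp add: mean_linear)
qed simp

lemma mean_cong:
  "(\<And>e. e \<in> clocks \<Longrightarrow> f (act e s) (relocate e p) = g (act e s) (relocate e p)) \<Longrightarrow>
    mean f s p = mean g s p"
  unfolding mean_def by simp

lemma mean_mono:
  "(\<And>e. e \<in> clocks \<Longrightarrow> f (act e s) (relocate e p) \<le> g (act e s) (relocate e p)) \<Longrightarrow>
    mean f s p \<le> mean g s p"
  unfolding mean_def using total_pos ring_rate_nonneg
  by (intro divide_right_mono sum_mono mult_left_mono) auto

lemma length_act:
  assumes "e \<in> clocks" "s \<in> network_states K" "p < K"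
  shows "length (s ! p) \<le> length (act e s ! relocate e p) + 1"
    and "length (act e s ! relocate e p) \<le> length (s ! p) + 1"
proof -
  from assms(1) consider
    (a) v w where "e = Arrival v w" "v < K" "w < K" | (b) v where "e = Service v" "v < K"
    | (c) u where "e = Swap u" "u < K"
    unfolding clocks_def by auto
  then have "length (s ! p) \<le> length (act e s ! relocate e p) + 1 \<and>
    length (act e s ! relocate e p) \<le> length (s ! p) + 1"
  proof cases
    case a
    then show ?thesis using assms by (simp add: nth_enqueue)
  next
    case b
    then show ?thesis using assms by (auto simp: nth_serve)
  next
    case c
    then show ?thesis using assms by (simp add: nth_swap_queues)
  qed
  then show "length (s ! p) \<le> length (act e s ! relocate e p) + 1"
    "length (act e s ! relocate e p) \<le> length (s ! p) + 1" by auto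
qed

lemma long_queues_act:
  assumes "e \<in> clocks" "s \<in> network_states K" "\<And>a. a < K \<Longrightarrow> Suc k < length (s ! a)" "a < K"
  shows "k < length (act e s ! a)"
proof -
  obtain p where "p < K" "a = relocate e p"
    using bij_relocate[OF assms(1)] assms(4) unfolding bij_betw_def by (metis imageE lessThan_iff)
  then show ?thesis using length_act(1)[OF assms(1,2), of p] assms(3)[of p] by simp
qed

text \<open>From queues longer than \<open>k\<close>, the chain meets no empty queue during
  \<open>k\<close> steps, so identities valid off the boundary may be used under
  \<open>mean ^^ k\<close>.\<close>

lemma mean_pow_cong:
  assumes eq: "\<And>s p. s \<in> network_states K \<Longrightarrow> (\<And>a. a < K \<Longrightarrow> s ! a \<noteq> []) \<Longrightarrow> p < K \<Longrightarrow> f s p = g s p"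
    and "s \<in> network_states K" "\<And>a. a < K \<Longrightarrow> k < length (s ! a)" "p < K"
  shows "(mean ^^ k) f s p = (mean ^^ k) g s p"
  using assms(2-)
proof (induction k arbitrary: s p)
  case 0
  then show ?case by (auto intro!: eq)
next
  case (Suc k)
  have "mean ((mean ^^ k) f) s p = mean ((mean ^^ k) g) s p"
    using Suc.prems by (intro mean_cong Suc.IH act_network_states long_queues_act relocate_less)
  then show ?case by simp
qed

text \<open>The expected length after a uniformly chosen number of steps below \<open>n\<close>. Its
  one-step drift telescopes to the \<open>n\<close>-step drift of the length divided by
  \<open>n\<close>.\<close>

definition smooth_length :: "nat \<Rightarrow> queues \<Rightarrow> nat \<Rightarrow> real" where
  "smooth_length n s p = (\<Sum>k<n. (mean ^^ k) queue_length s p) / n"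

lemma mean_smooth_length:
  "mean (smooth_length n) s p - smooth_length n s p = ((mean ^^ n) queue_length s p - queue_length s p) / n"
proof -
  have "mean (smooth_length n) s p = (\<Sum>k<n. mean ((mean ^^ k) queue_length) s p) / n"
    unfolding smooth_length_def mean_def
    by (simp add: sum_divide_distrib sum_distrib_left sum.swap[of _ clocks] field_simps)
  then have "mean (smooth_length n) s p - smooth_length n s p
    = (\<Sum>k<n. (mean ^^ Suc k) queue_length s p - (mean ^^ k) queue_length s p) / n"
    by (simp add: smooth_length_def sum_subtractf diff_divide_distrib)
  then show ?thesis
    using sum_lessThan_telescope[of "\<lambda>k. (mean ^^ k) queue_length s p" n] by simp
qed

text \<open>The increment is the expectation, \<open>k\<close> steps ahead, of the drift in
  \<open>mean_queue_length\<close>; each of the \<open>K - 1\<close> other servers contributes at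
  least \<open>r\<close> to the inflow.\<close>

lemma mean_pow_queue_length_diff:
  fixes r :: real
  assumes s: "s \<in> network_states K" "\<And>a. a < K \<Longrightarrow> k < length (s ! a)" "p < K"
    and r: "hop_bound k r"
  shows "(lam - 1 + (K - 1) * r) / total \<le> (mean ^^ Suc k) queue_length s p - (mean ^^ k) queue_length s p"
proof -
  let ?g = "\<lambda>s p. (lam - 1) / total + (1 / total) * inflow s p + 0 * inflow s p"
  have "(mean ^^ Suc k) queue_length s p - (mean ^^ k) queue_length s p
    = (mean ^^ k) (\<lambda>s p. 0 + 1 * mean queue_length s p + (- 1) * queue_length s p) s p"
    unfolding mean_pow_linear by (simp add: funpow_swap1)
  also have "\<dots> = (mean ^^ k) ?g s p"
    by (rule mean_pow_cong) (use s mean_queue_length in \<open>auto simp: add_divide_distrib diff_divide_distrib\<close>)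
  also have "\<dots> = (lam - 1 + (\<Sum>a\<in>{..<K} - {p}. hop_prob k (s ! a) a p)) / total"
    unfolding mean_pow_linear using mean_pow_inflow[OF s] by (simp add: add_divide_distrib diff_divide_distrib)
  finally have eq: "(mean ^^ Suc k) queue_length s p - (mean ^^ k) queue_length s p
    = (lam - 1 + (\<Sum>a\<in>{..<K} - {p}. hop_prob k (s ! a) a p)) / total" .
  have "(\<Sum>a\<in>{..<K} - {p}. r) \<le> (\<Sum>a\<in>{..<K} - {p}. hop_prob k (s ! a) a p)"
    using s network_states_nth[OF s(1)] by (intro sum_mono hop_boundD[OF r]) (auto simp: pairs_def)
  then show ?thesis
    unfolding eq using total_pos \<open>p < K\<close> by (intro divide_right_mono) auto
qed

lemma abs_mean_pow_queue_length:
  assumes "s \<in> network_states K" "p < K"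
  shows "\<bar>(mean ^^ k) queue_length s p - queue_length s p\<bar> \<le> k"
  using assms
proof (induction k arbitrary: s p)
  case (Suc k)
  let ?F = "(mean ^^ k) queue_length" and ?l = "queue_length s p"
  have d: "\<bar>?F (act e s) (relocate e p) - ?l\<bar> \<le> real (Suc k)" if e: "e \<in> clocks" for e
    using Suc.IH[OF act_network_states[OF e] relocate_less[OF e]] Suc.prems
      length_act[OF e Suc.prems(1,2)] unfolding queue_length_def
    by (fastforce simp: abs_le_iff)
  have const: "mean (\<lambda>s p. c) s p = c" for c
    using mean_linear[of c 0 "\<lambda>s p. 0" 0 "\<lambda>s p. 0"] by simp
  have "mean ?F s p \<le> mean (\<lambda>s p. ?l + Suc k) s p"
    by (rule mean_mono) (use d in \<open>fastforce simp: abs_le_iff\<close>)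
  moreover have "mean (\<lambda>s p. ?l - Suc k) s p \<le> mean ?F s p"
    by (rule mean_mono) (use d in \<open>fastforce simp: abs_le_iff\<close>)
  ultimately show ?case unfolding const by (simp add: abs_le_iff)
qed simp

lemma abs_smooth_length:
  assumes "s \<in> network_states K" "p < K" "0 < n"
  shows "\<bar>smooth_length n s p - queue_length s p\<bar> \<le> n"
proof -
  have "smooth_length n s p - queue_length s p
    = (\<Sum>k<n. (mean ^^ k) queue_length s p - queue_length s p) / n"
    using \<open>0 < n\<close> by (simp add: smooth_length_def sum_subtractf diff_divide_distrib)
  moreover have "\<bar>\<Sum>k<n. (mean ^^ k) queue_length s p - queue_length s p\<bar> \<le> (\<Sum>k<n. real n)"
    by (rule order_trans[OF sum_abs], rule sum_mono)
       (use abs_mean_pow_queue_length[OF assms(1,2)] in \<open>force intro: order_trans\<close>)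
  ultimately show ?thesis
    using \<open>0 < n\<close> by (simp add: abs_divide divide_le_eq)
qed

text \<open>Smoothing displaces the length by at most \<open>n\<close> before and after the ring,
  and the ring itself changes it by at most 1.\<close>

lemma smooth_length_act:
  assumes "e \<in> clocks" "s \<in> network_states K" "p < K" "0 < n"
  shows "\<bar>smooth_length n (act e s) (relocate e p) - smooth_length n s p\<bar> \<le> 2 * real n + 1"
  using abs_smooth_length[OF assms(2-4)] length_act[OF assms(1-3)]
    abs_smooth_length[OF act_network_states[OF assms(1,2)] relocate_less[OF assms(1,3)] assms(4)]
  unfolding queue_length_def abs_le_iff by linarith

lemma ex_positive_drift:
  assumes large: "3 < K * lam"
  shows "\<exists>n>0. \<exists>\<delta>>0. \<forall>s p. s \<in> network_states K \<longrightarrow> (\<forall>a<K. n \<le> length (s ! a)) \<longrightarrow> p < K \<longrightarrow>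
    smooth_length n s p + \<delta> \<le> mean (smooth_length n) s p"
proof -
  \<comment> \<open>This is \<open>lam - 3 / K\<close>, up to the factor \<open>1 / total\<close>
    the drift bound under perfect equidistribution; \<open>\<epsilon>\<close> is chosen to give away
    half of it.\<close>
  define \<gamma> where "\<gamma> = lam - 1 + (K - 1) * avg"
  have "\<gamma> = (K * lam - 3) / K"
    using K_ge_3 unfolding \<gamma>_def avg_def by (simp add: field_simps of_nat_diff)
  then have \<gamma>: "0 < \<gamma>" using large K_ge_3 by simp
  define \<epsilon> where "\<epsilon> = \<gamma> / (2 * (real K - 1))"
  have \<epsilon>: "0 < \<epsilon>" using \<gamma> K_ge_3 by (simp add: \<epsilon>_def)
  obtain k0 where k0: "\<And>k. k \<ge> k0 \<Longrightarrow> hop_bound k (avg - \<epsilon>)"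
    using eventually_hop_bound[OF \<epsilon>] by blast
  have half: "lam - 1 + (K - 1) * (avg - \<epsilon>) = \<gamma> / 2"
    using K_ge_3 unfolding \<gamma>_def[symmetric] right_diff_distrib
    by (simp add: \<epsilon>_def \<gamma>_def of_nat_diff field_simps)
  \<comment> \<open>Each of the first \<open>k0\<close> increments may cost 1 and each later one
    gains \<open>\<gamma> / 2\<close>, in units of \<open>1 / total\<close>. The choice of
    \<open>n\<close> makes the balance \<open>D\<close> positive.\<close>
  obtain n where n: "k0 + 2 * k0 / \<gamma> < real n" using reals_Archimedean2 by blast
  have "0 \<le> 2 * k0 / \<gamma>" using \<gamma> by simp
  then have k0n: "k0 < n" using n \<gamma> by linarith
  define D where "D = - real k0 + (real n - real k0) * (\<gamma> / 2)"
  have D: "0 < D" using n \<gamma> unfolding D_def by (simp add: field_simps)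
  define \<delta> where "\<delta> = D / total / n"
  have "smooth_length n s p + \<delta> \<le> mean (smooth_length n) s p"
    if s: "s \<in> network_states K" "\<forall>a<K. n \<le> length (s ! a)" and p: "p < K" for s p
  proof -
    let ?d = "\<lambda>k. if k < k0 then - 1 else \<gamma> / 2"
    have "?d k / total \<le> (mean ^^ Suc k) queue_length s p - (mean ^^ k) queue_length s p" if "k < n" for k
    proof -
      have len: "k < length (s ! a)" if "a < K" for a using s(2) that \<open>k < n\<close> by (meson less_le_trans)
      show ?thesis
      proof (cases "k < k0")
        case True
        \<comment> \<open>Before mixing only the nonnegativity of the inflow is available, and
          \<open>lam - 1\<close> exceeds -1.\<close>
        have "hop_bound k 0" by (simp add: hop_bound_def hop_prob_nonneg)
        from mean_pow_queue_length_diff[OF s(1) len p this]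
        have "(lam - 1) / total \<le> (mean ^^ Suc k) queue_length s p - (mean ^^ k) queue_length s p" by simp
        moreover have "- 1 / total \<le> (lam - 1) / total"
          using lam_pos total_pos by (intro divide_right_mono) auto
        ultimately show ?thesis using True by simp
      next
        case False
        from mean_pow_queue_length_diff[OF s(1) len p k0[of k]] False
        show ?thesis unfolding half by simp
      qed
    qed
    then have "(\<Sum>k<n. ?d k / total) \<le> (\<Sum>k<n. (mean ^^ Suc k) queue_length s p - (mean ^^ k) queue_length s p)"
      by (intro sum_mono) auto
    also have "\<dots> = (mean ^^ n) queue_length s p - queue_length s p"
      using sum_lessThan_telescope[of "\<lambda>k. (mean ^^ k) queue_length s p" n] by simp
    finally have le: "(\<Sum>k<n. ?d k / total) \<le> (mean ^^ n) queue_length s p - queue_length s p" .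
    have "(\<Sum>k<n. ?d k) = (\<Sum>k<k0. ?d k) + (\<Sum>k\<in>{k0..<n}. ?d k)"
      using k0n by (subst sum.union_disjoint[symmetric]) (auto intro!: sum.cong)
    also have "\<dots> = D" using k0n by (simp add: D_def of_nat_diff)
    finally have "D / total \<le> (mean ^^ n) queue_length s p - queue_length s p"
      using le by (simp add: sum_divide_distrib[symmetric])
    then have "\<delta> \<le> ((mean ^^ n) queue_length s p - queue_length s p) / n"
      unfolding \<delta>_def by (intro divide_right_mono) auto
    then show ?thesis using mean_smooth_length[of n s p] by simp
  qed
  moreover have "0 < \<delta>" using D total_pos k0n by (simp add: \<delta>_def)
  ultimately show ?thesis using k0n by (intro exI[of _ n] conjI exI[of _ \<delta>]) auto
qed

section \<open>Exponentials of the averaged lengths\<close>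

lemma exp_minus_le: "\<bar>x\<bar> \<le> 1 \<Longrightarrow> exp (- x) \<le> 1 - x + x\<^sup>2" for x :: real
proof (cases "0 \<le> x")
  case True
  \<comment> \<open>The product equals \<open>1 + x ^ 3\<close>.\<close>
  have "1 \<le> (1 + x) * (1 - x + x\<^sup>2)"
    using True by (simp add: algebra_simps power2_eq_square)
  also have "\<dots> \<le> exp x * (1 - x + x\<^sup>2)"
  proof (rule mult_right_mono)
    have "0 \<le> (1 - x / 2)\<^sup>2 + 3 / 4 * x\<^sup>2" by (intro add_nonneg_nonneg) auto
    also have "\<dots> = 1 - x + x\<^sup>2" by (simp add: power2_eq_square algebra_simps)
    finally show "0 \<le> 1 - x + x\<^sup>2" .
  qed simp
  finally show ?thesis by (simp add: exp_minus divide_simps mult.commute)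
next
  case False
  then show "exp (- x) \<le> 1 - x + x\<^sup>2" if "\<bar>x\<bar> \<le> 1" using exp_bound[of "- x"] that by simp
qed

definition lyapunov :: "nat \<Rightarrow> real \<Rightarrow> queues \<Rightarrow> real" where
  "lyapunov n \<theta> s = (\<Sum>p<K. exp (- \<theta> * smooth_length n s p))"

lemma lyapunov_nonneg: "0 \<le> lyapunov n \<theta> s"
  unfolding lyapunov_def by (intro sum_nonneg) auto

lemma lyapunov_pos: "0 < lyapunov n \<theta> s"
  unfolding lyapunov_def using K_ge_3 by (intro sum_pos) (auto simp: lessThan_empty_iff)

text \<open>A ring permutes the locations, so the sum over locations after it is a sum over followed
  servers, and estimates for single servers add up.\<close>

lemma sum_clocks_lyapunov:
  "(\<Sum>e\<in>clocks. ring_rate e * lyapunov n \<theta> (act e s))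
    = total * (\<Sum>p<K. mean (\<lambda>s p. exp (- \<theta> * smooth_length n s p)) s p)"
proof -
  have "lyapunov n \<theta> (act e s) = (\<Sum>p<K. exp (- \<theta> * smooth_length n (act e s) (relocate e p)))"
    if "e \<in> clocks" for e
    unfolding lyapunov_def by (rule sum.reindex_bij_betw[OF bij_relocate[OF that], symmetric])
  then have "(\<Sum>e\<in>clocks. ring_rate e * lyapunov n \<theta> (act e s))
    = (\<Sum>e\<in>clocks. \<Sum>p<K. ring_rate e * exp (- \<theta> * smooth_length n (act e s) (relocate e p)))"
    by (simp add: sum_distrib_left)
  also have "\<dots> = (\<Sum>p<K. \<Sum>e\<in>clocks. ring_rate e * exp (- \<theta> * smooth_length n (act e s) (relocate e p)))"
    by (rule sum.swap)
  finally show ?thesis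
    using total_pos unfolding mean_def sum_divide_distrib[symmetric] by simp
qed

text \<open>Second-order expansion for each server: the gain \<open>\<theta> * \<delta>\<close>
  outweighs the quadratic error, by the third condition on \<open>\<theta>\<close>; the second keeps
  the exponents within the range of \<open>exp_minus_le\<close>.\<close>

lemma lyapunov_superharmonic:
  assumes "0 < n" and drift: "\<And>p. p < K \<Longrightarrow> smooth_length n s p + \<delta> \<le> mean (smooth_length n) s p"
    and s: "s \<in> network_states K"
    and \<theta>: "0 < \<theta>" "\<theta> * (2 * real n + 1) \<le> 1" "\<theta> * (2 * real n + 1)\<^sup>2 \<le> \<delta>"
  shows "(\<Sum>e\<in>clocks. ring_rate e * lyapunov n \<theta> (act e s)) \<le> total * lyapunov n \<theta> s"
proof -
  let ?B = "2 * real n + 1"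
  have "mean (\<lambda>s p. exp (- \<theta> * smooth_length n s p)) s p \<le> exp (- \<theta> * smooth_length n s p)"
    if p: "p < K" for p
  proof -
    let ?X = "smooth_length n s p"
    let ?E = "exp (- \<theta> * ?X)"
    have "mean (\<lambda>s p. exp (- \<theta> * smooth_length n s p)) s p
      \<le> mean (\<lambda>s p. ?E * (1 + \<theta> * ?X + (\<theta> * ?B)\<^sup>2) + (- ?E * \<theta>) * smooth_length n s p + 0 * smooth_length n s p) s p"
    proof (rule mean_mono)
      fix e assume e: "e \<in> clocks"
      let ?Y = "smooth_length n (act e s) (relocate e p)"
      define d where "d = \<theta> * (?Y - ?X)"
      have "\<bar>d\<bar> \<le> \<theta> * ?B"
        using smooth_length_act[OF e s p \<open>0 < n\<close>] \<theta> unfolding d_def abs_mult by (intro mult_mono) auto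
      then have d: "\<bar>d\<bar> \<le> 1" "d\<^sup>2 \<le> (\<theta> * ?B)\<^sup>2"
        using \<theta> abs_le_square_iff[of d "\<theta> * ?B"] by (linarith, simp)
      have "exp (- \<theta> * ?Y) = ?E * exp (- d)"
        by (simp add: d_def exp_add[symmetric] algebra_simps)
      also have "\<dots> \<le> ?E * (1 - d + (\<theta> * ?B)\<^sup>2)"
        using exp_minus_le[OF d(1)] d(2) by (intro mult_left_mono) auto
      finally show "exp (- \<theta> * ?Y)
        \<le> ?E * (1 + \<theta> * ?X + (\<theta> * ?B)\<^sup>2) + (- ?E * \<theta>) * ?Y + 0 * ?Y"
        by (simp add: d_def algebra_simps)
    qed
    also have "\<dots> = ?E * (1 + \<theta> * (\<theta> * ?B\<^sup>2) - \<theta> * (mean (smooth_length n) s p - ?X))"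
      unfolding mean_linear by (simp add: algebra_simps power2_eq_square)
    also have "\<dots> \<le> ?E * 1"
    proof (rule mult_left_mono)
      have "\<theta> * (\<theta> * ?B\<^sup>2) \<le> \<theta> * \<delta>" using \<theta> by (intro mult_left_mono) auto
      also have "\<dots> \<le> \<theta> * (mean (smooth_length n) s p - ?X)"
        using \<theta> drift[OF p] by (intro mult_left_mono) auto
      finally show "1 + \<theta> * (\<theta> * ?B\<^sup>2) - \<theta> * (mean (smooth_length n) s p - ?X) \<le> 1" by simp
    qed simp
    finally show ?thesis by simp
  qed
  then show ?thesis
    unfolding sum_clocks_lyapunov unfolding lyapunov_def
    using total_pos by (intro mult_left_mono sum_mono) auto
qed

text \<open>Where \<open>U\<close> equals its maximum \<open>c\<close> nothing is to be shown; this
  includes the lists that are not network states, on which the criterion also has to hold. Where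
  \<open>U\<close> is below \<open>c\<close> all queues have length at least \<open>n\<close>, so
  the drift is available.\<close>

lemma truncated_lyapunov_superharmonic:
  assumes "0 < n"
    and drift: "\<And>s p. s \<in> network_states K \<Longrightarrow> (\<forall>a<K. n \<le> length (s ! a)) \<Longrightarrow> p < K \<Longrightarrow>
      smooth_length n s p + \<delta> \<le> mean (smooth_length n) s p"
    and \<theta>: "0 < \<theta>" "\<theta> * (2 * real n + 1) \<le> 1" "\<theta> * (2 * real n + 1)\<^sup>2 \<le> \<delta>"
    and c: "0 \<le> c" "c \<le> exp (- \<theta> * (2 * n))"
  defines "U \<equiv> \<lambda>s. if s \<in> network_states K then min (lyapunov n \<theta> s) c else c"
  shows "jump_mean (network_rate K arr \<beta>) (\<lambda>s. ennreal (U s)) s \<le> ennreal (U s)"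
proof -
  have U: "0 \<le> U s" "U s \<le> c" for s
    using c lyapunov_nonneg unfolding U_def by auto
  show ?thesis
  proof (rule clocks_superharmonic[OF finite_clocks ring_rate_nonneg network_rate_eq U(1)])
    have c_bound: "(\<Sum>e\<in>clocks. ring_rate e * U (act e s)) \<le> total * c"
      unfolding sum_ring_rate[symmetric] sum_distrib_right
      using U(2) ring_rate_nonneg by (intro sum_mono mult_left_mono) auto
    have "(\<Sum>e\<in>clocks. ring_rate e * U (act e s)) \<le> total * U s"
    proof (cases "U s = c")
      case False
      then have s: "s \<in> network_states K" and less: "lyapunov n \<theta> s < c"
        by (auto simp: U_def split: if_splits)
      have long: "n \<le> length (s ! a)" if a: "a < K" for a
      proof (rule ccontr)
        assume "\<not> n \<le> length (s ! a)"
        \<comment> \<open>A length below \<open>n\<close> plus a smoothing error of at most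
          \<open>n\<close>: the origin of \<open>2 * n\<close> in the truncation level.\<close>
        then have "smooth_length n s a \<le> 2 * n"
          using abs_smooth_length[OF s a \<open>0 < n\<close>] by (simp add: queue_length_def abs_le_iff)
        then have "c \<le> exp (- \<theta> * smooth_length n s a)"
          using c(2) \<theta>(1) by (intro order_trans[OF c(2)]) (simp add: mult_left_mono)
        also have "\<dots> \<le> lyapunov n \<theta> s"
          unfolding lyapunov_def using a by (intro member_le_sum) auto
        finally show False using less by simp
      qed
      have "(\<Sum>e\<in>clocks. ring_rate e * U (act e s)) \<le> (\<Sum>e\<in>clocks. ring_rate e * lyapunov n \<theta> (act e s))"
        using act_network_states[OF _ s] ring_rate_nonneg
        by (intro sum_mono mult_left_mono) (auto simp: U_def)
      also have "\<dots> \<le> total * lyapunov n \<theta> s"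
        using drift[OF s] long by (intro lyapunov_superharmonic[OF \<open>0 < n\<close> _ s \<theta>]) auto
      finally show ?thesis using s less by (simp add: U_def)
    qed (use c_bound in simp)
    then show "(\<Sum>e\<in>clocks. ring_rate e * U (act e s)) \<le> (\<Sum>e\<in>clocks. ring_rate e) * U s"
      by (simp add: sum_ring_rate)
  qed
qed

text \<open>Exogenous arrivals alone suffice: as \<open>lam\<close> is positive, every node has a
  destination with positive arrival rate, and each such arrival at a short queue reduces the total
  number of missing customers.\<close>

lemma reach_long_queues:
  assumes "s \<in> network_states K"
  shows "\<exists>t \<in> network_states K. (\<forall>a<K. M \<le> length (t ! a)) \<and>
    (s, t) \<in> {(x, y). y \<in> set_pmf (jump_pmf (network_rate K arr \<beta>) x)}\<^sup>*"
  using assms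
proof (induction "\<Sum>a<K. M - length (s ! a)" arbitrary: s rule: less_induct)
  case less
  note s = \<open>s \<in> network_states K\<close>
  show ?case
  proof (cases "\<forall>a<K. M \<le> length (s ! a)")
    case True
    then show ?thesis using s by blast
  next
    case False
    then obtain v where v: "v < K" "length (s ! v) < M" by auto
    have "\<exists>w<K. 0 < arr v w"
    proof (rule ccontr)
      assume "\<not> ?thesis"
      then have "(\<Sum>w<K. arr v w) \<le> 0" by (intro sum_nonpos) auto
      then show False using sum_arr[OF v(1)] lam_pos by simp
    qed
    then obtain w where w: "w < K" "0 < arr v w" by blast
    let ?t = "enqueue v w s"
    have e: "Arrival v w \<in> clocks" using v w by (auto simp: clocks_def)
    have t: "?t \<in> network_states K" using act_network_states[OF e s] by simp
    have nth: "?t ! a = (if a = v then s ! a @ [w] else s ! a)" if "a < K" for a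
      using nth_enqueue[OF s that] .
    have "?t \<noteq> s" using nth[OF v(1)] by auto
    moreover have "0 < network_rate K arr \<beta> s ?t"
    proof -
      have "ring_rate (Arrival v w) * of_bool (act (Arrival v w) s = ?t) \<le> network_rate K arr \<beta> s ?t"
        unfolding network_rate_eq using e ring_rate_nonneg by (intro member_le_sum) auto
      then show ?thesis using w by simp
    qed
    ultimately have step: "?t \<in> set_pmf (jump_pmf (network_rate K arr \<beta>) s)"
      by (intro clocks_set_jump_pmf[OF finite_clocks ring_rate_nonneg network_rate_eq])
    have "(\<Sum>a<K. M - length (?t ! a)) < (\<Sum>a<K. M - length (s ! a))"
      using v nth by (intro sum_strict_mono_ex1) auto
    from less.hyps[OF this t] step show ?thesis
      by (blast intro: converse_rtrancl_into_rtrancl)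
  qed
qed

lemma ex_lyapunov_less:
  assumes "0 < \<theta>" "0 < n" "0 < c"
  shows "\<exists>M. \<forall>s\<in>network_states K. (\<forall>a<K. M \<le> length (s ! a)) \<longrightarrow> lyapunov n \<theta> s < c"
proof -
  \<comment> \<open>Smoothing costs at most \<open>n\<close>, and each of the \<open>K\<close>
    exponentials has to fall below \<open>c / K\<close>.\<close>
  obtain M :: nat where M: "real n - ln (c / K) / \<theta> < M" using reals_Archimedean2 by blast
  have "lyapunov n \<theta> s < c" if s: "s \<in> network_states K" "\<forall>a<K. M \<le> length (s ! a)" for s
  proof -
    have "exp (- \<theta> * smooth_length n s p) < c / K" if p: "p < K" for p
    proof -
      have "real M \<le> queue_length s p"
        using s(2) p by (simp add: queue_length_def)
      then have "real M - n \<le> smooth_length n s p"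
        using abs_smooth_length[OF s(1) p \<open>0 < n\<close>] unfolding abs_le_iff by linarith
      then have "- ln (c / K) / \<theta> < smooth_length n s p" using M by linarith
      then have "- \<theta> * smooth_length n s p < ln (c / K)"
        using \<open>0 < \<theta>\<close> by (simp add: field_simps)
      then have "exp (- \<theta> * smooth_length n s p) < exp (ln (c / K))" by (simp only: exp_less_mono)
      then show ?thesis using \<open>0 < c\<close> K_ge_3 by simp
    qed
    then have "lyapunov n \<theta> s < (\<Sum>p<K. c / K)"
      unfolding lyapunov_def using K_ge_3 by (intro sum_strict_mono) (auto simp: lessThan_empty_iff)
    then show ?thesis using K_ge_3 by simp
  qed
  then show ?thesis by blast
qed

lemma transient:
  assumes large: "3 < K * lam"
  shows "transient_ctmc (network_rate K arr \<beta>) (network_states K)"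
  unfolding transient_ctmc_def
proof
  fix x assume x: "x \<in> network_states K"
  obtain n \<delta> where n: "0 < n" "0 < \<delta>"
    and drift: "\<And>s p. s \<in> network_states K \<Longrightarrow> (\<forall>a<K. n \<le> length (s ! a)) \<Longrightarrow> p < K \<Longrightarrow>
      smooth_length n s p + \<delta> \<le> mean (smooth_length n) s p"
    using ex_positive_drift[OF large] by blast
  define B where "B = 2 * real n + 1"
  have B: "0 < B" by (simp add: B_def)
  define \<theta> where "\<theta> = min (1 / B) (\<delta> / B\<^sup>2)"
  have \<theta>: "0 < \<theta>" "\<theta> * B \<le> 1" "\<theta> * B\<^sup>2 \<le> \<delta>"
  proof -
    show "0 < \<theta>" using B n by (simp add: \<theta>_def)
    have "\<theta> \<le> 1 / B" "\<theta> \<le> \<delta> / B\<^sup>2" by (simp_all add: \<theta>_def)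
    then show "\<theta> * B \<le> 1" "\<theta> * B\<^sup>2 \<le> \<delta>" using B by (simp_all add: pos_le_divide_eq)
  qed
  text \<open>The truncation level depends on \<open>x\<close>, so that \<open>x\<close> is a maximum of the truncated function.\<close>
  define c where "c = min (lyapunov n \<theta> x) (exp (- \<theta> * (2 * n)))"
  have c: "0 < c" using lyapunov_pos by (simp add: c_def)
  define U where "U s = (if s \<in> network_states K then min (lyapunov n \<theta> s) c else c)" for s
  let ?q = "network_rate K arr \<beta>" and ?f = "\<lambda>s. ennreal (U s)"
  have super: "jump_mean ?q ?f s \<le> ?f s" for s
    unfolding U_def
    by (rule truncated_lyapunov_superharmonic[OF n(1) drift \<theta>(1)])
       (use \<theta>(2,3)[unfolded B_def] c in \<open>simp_all add: c_def\<close>)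
  have Ux: "U x = c" using x by (simp add: U_def c_def)
  obtain M where M: "\<And>s. s \<in> network_states K \<Longrightarrow> (\<forall>a<K. M \<le> length (s ! a)) \<Longrightarrow> lyapunov n \<theta> s < c"
    using ex_lyapunov_less[OF \<theta>(1) n(1) c] by blast
  obtain y where y: "y \<in> network_states K" "\<forall>a<K. M \<le> length (y ! a)"
    "(x, y) \<in> {(x, y). y \<in> set_pmf (jump_pmf ?q x)}\<^sup>*"
    using reach_long_queues[OF x] by blast
  obtain m where m: "(x, y) \<in> {(x, y). y \<in> set_pmf (jump_pmf ?q x)} ^^ m"
    using rtrancl_imp_relpow[OF y(3)] by blast
  have "(jump_mean ?q ^^ m) ?f x < ennreal c"
  \<comment> \<open>\<open>x\<close> sits at the maximum \<open>c\<close>, and the state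
    \<open>y\<close> with long queues, reachable in \<open>m\<close> jumps, lies strictly
    below.\<close>
  proof (rule jump_mean_pow_drop[OF super _ _ m])
    show "?f s \<le> ennreal c" for s by (rule ennreal_leI) (simp add: U_def)
    show "?f y < ennreal c" using M[OF y(1,2)] y(1) c by (intro ennreal_lessI) (auto simp: U_def)
  qed simp
  then show "transient_state ?q x"
    using transient_stateI[OF super, of m x] by (simp add: Ux)
qed

end

theorem theorem3:
  fixes lam \<beta> :: real
  assumes "lam > 0" and "\<beta> > 0"
  shows "\<exists>Kstar::nat. Kstar > 0 \<and>
    (\<forall>K\<ge>Kstar. odd K \<and> K \<ge> 3 \<longrightarrow>
      (\<forall>arr. arrival_rates K lam arr \<longrightarrow>
        transient_ctmc (network_rate K arr \<beta>) (network_states K)))"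
proof -
  \<comment> \<open>The threshold depends on \<open>lam\<close> alone: it ensures that the drift
    \<open>lam - 3 / K\<close> is positive.\<close>
  obtain N :: nat where N: "3 / lam < N" using reals_Archimedean2 by blast
  have "transient_ctmc (network_rate K arr \<beta>) (network_states K)"
    if "Suc N \<le> K" "odd K" "3 \<le> K" "arrival_rates K lam arr" for K arr
  proof -
    interpret mobile_queues K arr lam \<beta>
      by unfold_locales (use that assms in auto)
    have "3 / lam < K" using N that by simp
    then have "3 < K * lam" using assms by (simp add: pos_divide_less_eq)
    then show ?thesis by (rule transient)
  qed
  then show ?thesis by (intro exI[of _ "Suc N"]) auto
qed

end
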